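(* Let $V$ be a $p\times p$ matrix satisfying the condition in the context with constants $r_k$, $k\le2K$, and suppose $2r_K<1$. Let $\delta\in(0,1)$, $B>0$, $\theta\in B(k)$ with $k\le K/2$ and $\|\theta\|_\infty\le B$. Let $\hat\theta^r$ be the iterative thresholding estimator of the context after $r=\log(n)/\log(1/(2r_K))$ iterations (rounded up to an integer), and define $$\hat\theta:=\hat\theta^r+\frac1nVX^T(Y-X\hat\theta^r),\qquad Z:=\frac1{\sqrt n}VX^T\epsilon,\qquad\Delta:=\sqrt n(I-V\hat\Sigma)(\hat\theta^r-\theta).$$ Then $$\sqrt n(\hat\theta-\theta)=\Delta+Z,\qquad Z\mid X\sim\mathcal N(0,V\hat\Sigma V^T).$$ If moreover $r_K=o(1)$ as $n\to\infty$ (e.g. for the random designs described in the context one can take $r_K=O(K\sqrt{(\log p)/n})$, so it suffices that $K=o(\sqrt n/\log p)$), then also $$\|\Delta\|_\infty=o_{\mathbb P}(1).$$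
   Context: Model. $Y=X\theta+\epsilon$, $X\in\mathbb R^{n\times p}$, $\theta\in\mathbb R^p$, $\epsilon\sim\mathcal N(0,I_n)$ independent of $X$, $p\gg n$; $\hat\Sigma=\frac1nX^TX$. $B(k)$ is the set of vectors in $\mathbb R^p$ with at most $k$ nonzero coordinates. In asymptotic statements $n\to\infty$ and $p$, $K$, $\theta$, $X$, $V$ may vary with $n$. Condition on $V$. $K\le p$, and for any $k\le2K$ there is a constant $r_k>0$ such that $\sup_{u\in B(k),u\neq0}\frac{\|V\hat\Sigma u-u\|_\infty}{\|u\|_\infty}\le r_k$. Procedure. For $u\in\mathbb R^p$ and $T>0$, $\lfloor u\rfloor_T$ has coordinates $u_i\mathbf 1\{|u_i|\ge T\}$. Set $\hat\theta^0=0$, $T_0=B$, $M=\max\mathrm{diag}(V\hat\Sigma V^T)$, $\upsilon=2\sqrt{M\log(p/\delta)/n}$, and for $r\ge1$: $T_r=2r_KT_{r-1}+\upsilon$, $\hat\alpha^r=\lfloor\frac1nVX^T(Y-X\hat\theta^{r-1})\rfloor_{T_r}$, $\hat\theta^r=\hat\theta^{r-1}+\hat\alpha^r$. Random designs of the example. The rows of $X$ have covariance $\Sigma\in\mathbb R^{p\times p}$ with $\sigma_{\min}(\Sigma)\ge C_{\min}>0$, $\sigma_{\max}(\Sigma)\le C_{\max}<\infty$, $\max_i\Sigma_{ii}\le1$, and $X\Sigma^{-1/2}$ has independent sub-Gaussian rows with zero mean and sub-Gaussian norm $\|\Sigma^{-1/2}X_1\|_{\psi_2}=\kappa$. Then for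 $n\ge C_{\min}\log p/(4e^2C_{\max}\kappa^4)$, with probability larger than $1-2p^{-c_2}$, $c_2=C_{\min}/(24e^2\kappa^4C_{\max})$, there exists a computationally feasible $V$ with $\|V\hat\Sigma-I\|_\infty\le\sqrt{(\log p)/n}$ (entrywise maximum norm), so that one can take $r_k=k\sqrt{(\log p)/n}$.
   Formalization: The claim that r_K=o(1) alone gives ‖Δ‖_∞=o_P(1) is false; it is proved assuming also r_K√(M log p)=o_P(1), or r_K=O(K√(log p/n)), K=o(√n/log p) and M=O_P(1). With r_K=o(1) alone, ‖Δ‖_∞/(1+√(M log p))=o_P(1) is proved. *)

theory Defs
  imports "HOL-Probability.Probability" "HOL-Library.Landau_Symbols" "Jordan_Normal_Form.Matrix"
begin

no_notation vec_nth (infixl "$" 90)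
hide_type (open) Finite_Cartesian_Product.vec
hide_const (open) Finite_Cartesian_Product.vec

section \<open>Laws of random vectors of variable dimension\<close>

text \<open>Vectors and matrices are those of the matrix library, whose dimensions are values; the
  sigma-algebras below are the Borel sigma-algebras of the coordinates.\<close>

definition vec_borel :: "nat \<Rightarrow> real vec measure" where
  "vec_borel n = vimage_algebra (carrier_vec n) (\<lambda>v. \<lambda>i\<in>{..<n}. v $ i) (\<Pi>\<^sub>M i\<in>{..<n}. borel)"

definition mat_borel :: "nat \<Rightarrow> nat \<Rightarrow> real mat measure" where
  "mat_borel n p = vimage_algebra (carrier_mat n p)
     (\<lambda>A. \<lambda>ij\<in>{..<n} \<times> {..<p}. A $$ ij) (\<Pi>\<^sub>M ij\<in>{..<n} \<times> {..<p}. borel)"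

definition normal_law :: "real \<Rightarrow> real \<Rightarrow> real measure" where
  "normal_law m v =
     (if v = 0 then return borel m else density lborel (\<lambda>x. ennreal (normal_density m (sqrt v) x)))"

text \<open>\<open>mv_normal d \<mu> S \<nu>\<close>: \<open>\<nu>\<close> is the law \<open>N(\<mu>, S)\<close> on d-dimensional space, i.e. every linear functional
  is normally distributed with the matching mean and variance. The covariance matrix \<open>S\<close> may be
  singular, as \<open>V \<Sigma> V\<^sup>T\<close> is when \<open>n < p\<close>.\<close>

definition mv_normal :: "nat \<Rightarrow> real vec \<Rightarrow> real mat \<Rightarrow> real vec measure \<Rightarrow> bool" where
  "mv_normal d \<mu> S \<nu> \<longleftrightarrow>
     \<mu> \<in> carrier_vec d \<and> S \<in> carrier_mat d d \<and> prob_space \<nu> \<and> sets \<nu> = sets (vec_borel d) \<and>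
     (\<forall>a\<in>carrier_vec d. distr \<nu> borel (\<lambda>v. scalar_prod a v) =
        normal_law (scalar_prod a \<mu>) (scalar_prod a (S *\<^sub>v a)))"

text \<open>\<open>\<kappa>\<close> is a regular conditional distribution of \<open>Z\<close> given \<open>X\<close>.\<close>

definition regular_cond_distr ::
  "'a measure \<Rightarrow> 'b measure \<Rightarrow> ('a \<Rightarrow> 'b) \<Rightarrow> 'c measure \<Rightarrow> ('a \<Rightarrow> 'c) \<Rightarrow> ('b \<Rightarrow> 'c measure) \<Rightarrow> bool" where
  "regular_cond_distr P N X L Z \<kappa> \<longleftrightarrow>
     X \<in> P \<rightarrow>\<^sub>M N \<and> Z \<in> P \<rightarrow>\<^sub>M L \<and> \<kappa> \<in> N \<rightarrow>\<^sub>M prob_algebra L \<and>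
     (\<forall>A\<in>sets N. \<forall>B\<in>sets L.
        emeasure P {\<omega> \<in> space P. X \<omega> \<in> A \<and> Z \<omega> \<in> B} =
        (\<integral>\<^sup>+\<omega>\<in>{\<omega> \<in> space P. X \<omega> \<in> A}. emeasure (\<kappa> (X \<omega>)) B \<partial>P))"

section \<open>Stochastic order symbols along a sequence of probability spaces\<close>

text \<open>Measurability is part of the definitions, since \<open>measure\<close> is \<open>0\<close> on non-measurable sets.\<close>

definition small_o_P_one :: "(nat \<Rightarrow> 'a measure) \<Rightarrow> (nat \<Rightarrow> 'a \<Rightarrow> real) \<Rightarrow> bool" where
  "small_o_P_one P f \<longleftrightarrow>
     (\<forall>\<^sub>F n in sequentially. f n \<in> borel_measurable (P n)) \<and>
     (\<forall>e>0. (\<lambda>n. measure (P n) {\<omega> \<in> space (P n). \<bar>f n \<omega>\<bar> > e}) \<longlonglongrightarrow> 0)"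

definition big_O_P_one :: "(nat \<Rightarrow> 'a measure) \<Rightarrow> (nat \<Rightarrow> 'a \<Rightarrow> real) \<Rightarrow> bool" where
  "big_O_P_one P f \<longleftrightarrow>
     (\<forall>\<^sub>F n in sequentially. f n \<in> borel_measurable (P n)) \<and>
     (\<forall>e>0. \<exists>C. \<forall>\<^sub>F n in sequentially.
        measure (P n) {\<omega> \<in> space (P n). \<bar>f n \<omega>\<bar> > C} \<le> e)"

definition holds_with_prob_tending_to_one ::
  "(nat \<Rightarrow> 'a measure) \<Rightarrow> (nat \<Rightarrow> 'a \<Rightarrow> bool) \<Rightarrow> bool" where
  "holds_with_prob_tending_to_one P Q \<longleftrightarrow>
     (\<exists>G. (\<forall>n. G n \<in> sets (P n) \<and> (\<forall>\<omega>\<in>G n. Q n \<omega>)) \<and> (\<lambda>n. measure (P n) (G n)) \<longlonglongrightarrow> 1)"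

section \<open>Sparse vectors and the condition on \<open>V\<close>\<close>

definition vec_linf :: "real vec \<Rightarrow> real" where
  "vec_linf v = Max (insert 0 ((\<lambda>i. \<bar>v $ i\<bar>) ` {..<dim_vec v}))"

definition mat_linf :: "real mat \<Rightarrow> real" where
  "mat_linf A = Max (insert 0 ((\<lambda>ij. \<bar>A $$ ij\<bar>) ` ({..<dim_row A} \<times> {..<dim_col A})))"

definition sparse_vecs :: "nat \<Rightarrow> nat \<Rightarrow> real vec set" where
  "sparse_vecs p k = {u \<in> carrier_vec p. card {i. i < p \<and> u $ i \<noteq> 0} \<le> k}"

definition gram :: "real mat \<Rightarrow> real mat" where
  "gram X = (1 / real (dim_row X)) \<cdot>\<^sub>m (X\<^sup>T * X)"

definition approx_inverse_cond :: "nat \<Rightarrow> (nat \<Rightarrow> real) \<Rightarrow> real mat \<Rightarrow> real mat \<Rightarrow> bool" where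
  "approx_inverse_cond K r V X \<longleftrightarrow>
     (\<forall>k\<in>{1..2 * K}. \<forall>u\<in>sparse_vecs (dim_col X) k. u \<noteq> 0\<^sub>v (dim_col X) \<longrightarrow>
        vec_linf ((V * gram X) *\<^sub>v u - u) / vec_linf u \<le> r k)"

section \<open>Iterative thresholding and the debiased estimator\<close>

definition hard_threshold :: "real \<Rightarrow> real vec \<Rightarrow> real vec" where
  "hard_threshold T u = vec (dim_vec u) (\<lambda>i. if \<bar>u $ i\<bar> \<ge> T then u $ i else 0)"

definition max_var :: "real mat \<Rightarrow> real mat \<Rightarrow> real" where
  "max_var V X = Max (set (diag_mat (V * gram X * V\<^sup>T)))"

definition noise_level :: "real \<Rightarrow> real mat \<Rightarrow> real mat \<Rightarrow> real" where
  "noise_level \<delta> V X =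
     2 * sqrt (max_var V X * ln (real (dim_col X) / \<delta>) / real (dim_row X))"

text \<open>In the following, \<open>\<rho>\<close> stands for \<open>r\<^sub>K\<close>.\<close>

primrec threshold :: "real \<Rightarrow> real \<Rightarrow> real \<Rightarrow> real mat \<Rightarrow> real mat \<Rightarrow> nat \<Rightarrow> real" where
  "threshold \<rho> \<delta> B V X 0 = B"
| "threshold \<rho> \<delta> B V X (Suc t) = 2 * \<rho> * threshold \<rho> \<delta> B V X t + noise_level \<delta> V X"

definition correction :: "real mat \<Rightarrow> real mat \<Rightarrow> real vec \<Rightarrow> real vec \<Rightarrow> real vec" where
  "correction V X Y u = (1 / real (dim_row X)) \<cdot>\<^sub>v ((V * X\<^sup>T) *\<^sub>v (Y - X *\<^sub>v u))"

primrec iter_est ::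
  "real \<Rightarrow> real \<Rightarrow> real \<Rightarrow> real mat \<Rightarrow> real mat \<Rightarrow> real vec \<Rightarrow> nat \<Rightarrow> real vec" where
  "iter_est \<rho> \<delta> B V X Y 0 = 0\<^sub>v (dim_col X)"
| "iter_est \<rho> \<delta> B V X Y (Suc t) =
     iter_est \<rho> \<delta> B V X Y t +
     hard_threshold (threshold \<rho> \<delta> B V X (Suc t)) (correction V X Y (iter_est \<rho> \<delta> B V X Y t))"

definition num_iter :: "real \<Rightarrow> nat \<Rightarrow> nat" where
  "num_iter \<rho> n = nat \<lceil>ln (real n) / ln (1 / (2 * \<rho>))\<rceil>"

definition thresholding_est ::
  "real \<Rightarrow> real \<Rightarrow> real \<Rightarrow> real mat \<Rightarrow> real mat \<Rightarrow> real vec \<Rightarrow> real vec" where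
  "thresholding_est \<rho> \<delta> B V X Y = iter_est \<rho> \<delta> B V X Y (num_iter \<rho> (dim_row X))"

definition debiased_est ::
  "real \<Rightarrow> real \<Rightarrow> real \<Rightarrow> real mat \<Rightarrow> real mat \<Rightarrow> real vec \<Rightarrow> real vec" where
  "debiased_est \<rho> \<delta> B V X Y =
     thresholding_est \<rho> \<delta> B V X Y + correction V X Y (thresholding_est \<rho> \<delta> B V X Y)"

definition noise_term :: "real mat \<Rightarrow> real mat \<Rightarrow> real vec \<Rightarrow> real vec" where
  "noise_term V X e = (1 / sqrt (real (dim_row X))) \<cdot>\<^sub>v ((V * X\<^sup>T) *\<^sub>v e)"

definition bias_term ::
  "real \<Rightarrow> real \<Rightarrow> real \<Rightarrow> real mat \<Rightarrow> real mat \<Rightarrow> real vec \<Rightarrow> real vec \<Rightarrow> real vec" where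
  "bias_term \<rho> \<delta> B V X Y \<theta> =
     sqrt (real (dim_row X)) \<cdot>\<^sub>v
       ((1\<^sub>m (dim_col X) - V * gram X) *\<^sub>v (thresholding_est \<rho> \<delta> B V X Y - \<theta>))"

definition response :: "real mat \<Rightarrow> real vec \<Rightarrow> real vec \<Rightarrow> real vec" where
  "response X \<theta> e = X *\<^sub>v \<theta> + e"

section \<open>The model for one sample size\<close>

text \<open>The matrix \<open>V\<close> may depend on the design, hence is a measurable function of it; fixed designs
  and fixed \<open>V\<close> are the constant cases. The bound on \<open>V\<close> by the constants \<open>r\<close>, a property of the
  realised design, is not an assumption of the locale: see \<open>approx_inverse_cond\<close>.\<close>

locale sparse_regression = prob_space P for P :: "'a measure" +
  fixes n p K k :: nat and r :: "nat \<Rightarrow> real" and \<delta> B :: real and \<theta> :: "real vec"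
    and X :: "'a \<Rightarrow> real mat" and \<epsilon> :: "'a \<Rightarrow> real vec" and V :: "real mat \<Rightarrow> real mat"
  assumes n_pos: "0 < n"
    and X_measurable: "X \<in> P \<rightarrow>\<^sub>M mat_borel n p"
    and noise_measurable: "\<epsilon> \<in> P \<rightarrow>\<^sub>M vec_borel n"
    and noise_law: "mv_normal n (0\<^sub>v n) (1\<^sub>m n) (distr P (vec_borel n) \<epsilon>)"
    and noise_indep: "indep_set {X -` A \<inter> space P |A. A \<in> sets (mat_borel n p)}
      {\<epsilon> -` C \<inter> space P |C. C \<in> sets (vec_borel n)}"
    and V_measurable: "V \<in> mat_borel n p \<rightarrow>\<^sub>M mat_borel p p"
    and K_bounds: "1 \<le> K" "K \<le> p"
    and r_pos: "\<And>j. j \<in> {1..2 * K} \<Longrightarrow> 0 < r j"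
    and r_K_small: "2 * r K < 1"
    and delta_bounds: "0 < \<delta>" "\<delta> < 1"
    and B_pos: "0 < B"
    and theta_sparse: "\<theta> \<in> sparse_vecs p k" "real k \<le> real K / 2"
    and theta_bounded: "vec_linf \<theta> \<le> B"

end

theory Submission
  imports Defs
begin

text \<open>
  The correction step applied to a vector \<open>u\<close> yields \<open>V gram X (\<theta> - u)\<close> plus the noise
  \<open>w = (1/n) V X\<^sup>T \<epsilon>\<close> (lemma \<open>correction_response\<close>). Adding it to the final iterate gives the
  decomposition into bias and noise by linear algebra. Conditionally on the design the noise term is
  a linear image of a standard Gaussian vector with covariance \<open>V gram X V\<^sup>T\<close>; since \<open>X\<close> and \<open>\<epsilon>\<close> are
  independent, their joint law is a product and the law of that image for a fixed design
  (\<open>noise_kernel\<close>) is a regular conditional distribution.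

  The bias is small because the iteration contracts. On sparse vectors \<open>V gram X\<close> differs from the
  identity by the factor \<open>\<rho> = r\<^sub>K\<close>, so the correction reproduces the current error up to
  \<open>\<rho> \<parallel>\<theta> - u\<parallel>\<^sub>\<infinity> + \<parallel>w\<parallel>\<^sub>\<infinity>\<close>. As long as \<open>\<parallel>w\<parallel>\<^sub>\<infinity>\<close> stays below the noise level, the thresholds \<open>T\<^sub>t\<close> are
  large enough that no coordinate outside the support of \<open>\<theta>\<close> ever becomes active, and small enough that
  the error in round \<open>t\<close> is below \<open>2 T\<^sub>t\<close> (lemma \<open>iter_est_error\<close>). The thresholds decrease geometrically
  to a multiple of the noise level, and the prescribed number of rounds reduces the initial bound by
  the factor \<open>n\<close>. Hence \<open>\<parallel>\<Delta>\<parallel>\<^sub>\<infinity> \<le> 2 \<rho> B / \<surd>n + (4 \<rho> / (1 - 2 \<rho>)) \<surd>(M ln (p / \<delta>))\<close> with \<open>M\<close> the largest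
  variance (lemma \<open>bias_term_bound\<close>).

  The noise stays below its level with probability at least \<open>1 - 2 / \<surd>n\<close>: a Gaussian tail bound for each of
  the \<open>p\<close> coordinates given the design, a union bound, and integration over the design (lemmas
  \<open>normal_law_tail\<close>, \<open>noise_exceeds_prob\<close>). So outside events of vanishing probability
  \<open>\<parallel>\<Delta>\<parallel>\<^sub>\<infinity> \<le> C \<rho> (1 + \<surd>(M ln p))\<close> with \<open>C\<close> depending on \<open>B\<close> and \<open>\<delta>\<close> only, and each of the asymptotic
  conclusions compares this bound with its own hypothesis on \<open>\<rho>\<close> and \<open>M\<close>.
\<close>

section \<open>The supremum norm\<close>

lemma abs_index_le_vec_linf: "i < dim_vec v \<Longrightarrow> \<bar>v $ i\<bar> \<le> vec_linf v"
  unfolding vec_linf_def by (rule Max_ge) auto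

lemma vec_linf_nonneg: "0 \<le> vec_linf v"
  unfolding vec_linf_def by (rule Max_ge) auto

lemma vec_linf_le_iff: "0 \<le> c \<Longrightarrow> vec_linf v \<le> c \<longleftrightarrow> (\<forall>i<dim_vec v. \<bar>v $ i\<bar> \<le> c)"
  unfolding vec_linf_def by (subst Max_le_iff) auto

lemma vec_linf_less_iff: "0 < c \<Longrightarrow> vec_linf v < c \<longleftrightarrow> (\<forall>i<dim_vec v. \<bar>v $ i\<bar> < c)"
  unfolding vec_linf_def by (subst Max_less_iff) auto

lemma vec_linf_pos:
  assumes "v \<in> carrier_vec p" "v \<noteq> 0\<^sub>v p"
  shows "0 < vec_linf v"
proof -
  obtain i where "i < p" "v $ i \<noteq> 0"
    using assms by (metis carrier_vecD eq_vecI index_zero_vec(1) index_zero_vec(2))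
  then show ?thesis
    using abs_index_le_vec_linf[of i v] assms(1) by auto
qed

lemma vec_linf_zero [simp]: "vec_linf (0\<^sub>v p) = 0"
  using vec_linf_le_iff[of 0 "0\<^sub>v p"] vec_linf_nonneg[of "0\<^sub>v p"] by auto

lemma vec_linf_smult: "vec_linf (c \<cdot>\<^sub>v v) \<le> \<bar>c\<bar> * vec_linf v"
  by (subst vec_linf_le_iff)
    (auto simp: abs_mult vec_linf_nonneg intro!: mult_left_mono abs_index_le_vec_linf)

lemma abs_index_le_mat_linf: "i < dim_row A \<Longrightarrow> j < dim_col A \<Longrightarrow> \<bar>A $$ (i, j)\<bar> \<le> mat_linf A"
  unfolding mat_linf_def by (rule Max_ge) auto

lemma mat_linf_nonneg: "0 \<le> mat_linf A"
  unfolding mat_linf_def by (rule Max_ge) auto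

lemma gram_carrier [simp]: "X \<in> carrier_mat n p \<Longrightarrow> gram X \<in> carrier_mat p p"
  unfolding gram_def by auto

text \<open>A \<open>j\<close>-sparse vector satisfies \<open>\<parallel>u\<parallel>\<^sub>1 \<le> j \<parallel>u\<parallel>\<^sub>\<infinity>\<close>, so each coordinate of
  \<open>(V gram X - I) u\<close> is at most \<open>\<eta> \<parallel>u\<parallel>\<^sub>1 \<le> j \<eta> \<parallel>u\<parallel>\<^sub>\<infinity>\<close>.\<close>

lemma approx_inverse_cond_of_entrywise:
  assumes X: "X \<in> carrier_mat n q" and V: "V \<in> carrier_mat q q"
    and \<eta>: "mat_linf (V * gram X - 1\<^sub>m q) \<le> \<eta>"
  shows "approx_inverse_cond K (\<lambda>j. real j * \<eta>) V X"
  unfolding approx_inverse_cond_def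
proof (intro ballI impI)
  fix j u assume j: "j \<in> {1..2 * K}" and u: "u \<in> sparse_vecs (dim_col X) j" and u0: "u \<noteq> 0\<^sub>v (dim_col X)"
  let ?D = "V * gram X - 1\<^sub>m q" and ?S = "{i. i < q \<and> u $ i \<noteq> 0}"
  from X u have uq: "u \<in> carrier_vec q" and cS: "card ?S \<le> j" by (auto simp: sparse_vecs_def)
  have A: "V * gram X \<in> carrier_mat q q" using X V by (auto intro: mult_carrier_mat)
  have D: "?D \<in> carrier_mat q q" by auto
  have \<eta>0: "0 \<le> \<eta>" using \<eta> mat_linf_nonneg[of ?D] by linarith
  have eq: "(V * gram X) *\<^sub>v u - u = ?D *\<^sub>v u"
    using A uq by (simp add: minus_mult_distrib_mat_vec[where nr=q and nc=q])
  have "vec_linf (?D *\<^sub>v u) \<le> real j * \<eta> * vec_linf u"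
  proof (subst vec_linf_le_iff, intro mult_nonneg_nonneg)
    show "\<forall>i<dim_vec (?D *\<^sub>v u). \<bar>(?D *\<^sub>v u) $ i\<bar> \<le> real j * \<eta> * vec_linf u"
    proof (intro allI impI)
      fix i assume "i < dim_vec (?D *\<^sub>v u)"
      with D have i: "i < q" by simp
      have "(?D *\<^sub>v u) $ i = (\<Sum>l = 0..<q. ?D $$ (i, l) * u $ l)"
        using i D uq by (auto simp: scalar_prod_def)
      also have "\<dots> = (\<Sum>l\<in>?S. ?D $$ (i, l) * u $ l)"
        by (rule sum.mono_neutral_right) auto
      finally have "\<bar>(?D *\<^sub>v u) $ i\<bar> \<le> (\<Sum>l\<in>?S. \<bar>?D $$ (i, l) * u $ l\<bar>)"
        by simp
      also have "\<dots> \<le> (\<Sum>l\<in>?S. \<eta> * vec_linf u)"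
      proof (rule sum_mono)
        fix l assume l: "l \<in> ?S"
        have "\<bar>?D $$ (i, l)\<bar> \<le> \<eta>"
          using abs_index_le_mat_linf[of i ?D l] i l D \<eta> by auto
        moreover have "\<bar>u $ l\<bar> \<le> vec_linf u"
          using l uq by (intro abs_index_le_vec_linf) auto
        ultimately show "\<bar>?D $$ (i, l) * u $ l\<bar> \<le> \<eta> * vec_linf u"
          using \<eta>0 by (simp only: abs_mult) (intro mult_mono, auto)
      qed
      also have "\<dots> = real (card ?S) * (\<eta> * vec_linf u)" by simp
      also have "\<dots> \<le> real j * (\<eta> * vec_linf u)"
        using cS \<eta>0 by (intro mult_right_mono) (auto simp: vec_linf_nonneg)
      finally show "\<bar>(?D *\<^sub>v u) $ i\<bar> \<le> real j * \<eta> * vec_linf u" by (simp add: mult.assoc)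
    qed
  qed (auto simp: \<eta>0 vec_linf_nonneg)
  moreover have "0 < vec_linf u" using vec_linf_pos[OF uq] u0 X by auto
  ultimately show "vec_linf ((V * gram X) *\<^sub>v u - u) / vec_linf u \<le> real j * \<eta>"
    unfolding eq by (simp add: divide_le_eq)
qed

section \<open>Error analysis of the iteration\<close>

lemma smult_mat_mult_vec:
  fixes k :: "'a::comm_semiring_0"
  shows "dim_vec v = dim_col A \<Longrightarrow> (k \<cdot>\<^sub>m A) *\<^sub>v v = k \<cdot>\<^sub>v (A *\<^sub>v v)"
  by (intro eq_vecI) auto

lemma mult_gram:
  assumes "X \<in> carrier_mat n p" "V \<in> carrier_mat p p" "d \<in> carrier_vec p"
  shows "(V * gram X) *\<^sub>v d = (1 / real n) \<cdot>\<^sub>v ((V * X\<^sup>T) *\<^sub>v (X *\<^sub>v d))"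
proof -
  have X: "X\<^sup>T \<in> carrier_mat p n" "X\<^sup>T * X \<in> carrier_mat p p" "dim_row X = n" using assms by auto
  have "V * gram X = (1 / real n) \<cdot>\<^sub>m (V * (X\<^sup>T * X))"
    unfolding gram_def X(3) by (rule mult_smult_distrib[OF assms(2) X(2)])
  also have "V * (X\<^sup>T * X) = (V * X\<^sup>T) * X"
    using assms X by (simp add: assoc_mult_mat)
  finally have eq: "V * gram X = (1 / real n) \<cdot>\<^sub>m ((V * X\<^sup>T) * X)" .
  have "((V * X\<^sup>T) * X) *\<^sub>v d = (V * X\<^sup>T) *\<^sub>v (X *\<^sub>v d)"
    using assms X by (intro assoc_mult_mat_vec) auto
  then show ?thesis
    unfolding eq using assms X by (subst smult_mat_mult_vec) (auto simp del: assoc_mult_mat_vec)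
qed

text \<open>The correction sees the current error \<open>\<theta> - u\<close> only through \<open>V gram X\<close>, which is close to the
  identity on sparse vectors: hence it returns approximately that error, blurred by the noise.
  Both the decomposition into bias and noise and the contraction of the iteration come from here.\<close>

lemma correction_response:
  assumes X: "X \<in> carrier_mat n p" and V: "V \<in> carrier_mat p p" and e: "e \<in> carrier_vec n"
    and \<theta>: "\<theta> \<in> carrier_vec p" and u: "u \<in> carrier_vec p"
  shows "correction V X (response X \<theta> e) u =
     (V * gram X) *\<^sub>v (\<theta> - u) + (1 / real n) \<cdot>\<^sub>v ((V * X\<^sup>T) *\<^sub>v e)"
proof -
  have VX: "V * X\<^sup>T \<in> carrier_mat p n" using X V by auto
  have "response X \<theta> e - X *\<^sub>v u = X *\<^sub>v (\<theta> - u) + e"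
    using X e \<theta> u unfolding response_def
    by (subst mult_minus_distrib_mat_vec[OF X \<theta> u]) (intro eq_vecI, auto)
  moreover have "(V * X\<^sup>T) *\<^sub>v (X *\<^sub>v (\<theta> - u) + e) = (V * X\<^sup>T) *\<^sub>v (X *\<^sub>v (\<theta> - u)) + (V * X\<^sup>T) *\<^sub>v e"
    using X e \<theta> u VX by (intro mult_add_distrib_mat_vec) auto
  ultimately show ?thesis
    using X e \<theta> u VX V unfolding correction_def
    by (subst mult_gram[OF X V])
      (auto simp del: assoc_mult_mat_vec
        intro!: smult_add_distrib_vec[where n=p] mult_mat_vec_carrier[OF VX])
qed

lemma iter_est_carrier [simp]:
  "X \<in> carrier_mat n p \<Longrightarrow> V \<in> carrier_mat p p \<Longrightarrow> iter_est \<rho> \<delta> B V X Y t \<in> carrier_vec p"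
  by (induction t) (auto simp: hard_threshold_def correction_def)

lemma debiased_decomposition:
  assumes X: "X \<in> carrier_mat n p" and V: "V \<in> carrier_mat p p" and e: "e \<in> carrier_vec n"
    and \<theta>: "\<theta> \<in> carrier_vec p" and n: "0 < n"
  shows "sqrt (real n) \<cdot>\<^sub>v (debiased_est \<rho> \<delta> B V X (response X \<theta> e) - \<theta>) =
     bias_term \<rho> \<delta> B V X (response X \<theta> e) \<theta> + noise_term V X e"
proof -
  define u where "u = thresholding_est \<rho> \<delta> B V X (response X \<theta> e)"
  have u: "u \<in> carrier_vec p" using X V unfolding u_def thresholding_est_def by auto
  have A: "V * gram X \<in> carrier_mat p p" using V X by (auto intro: mult_carrier_mat)
  have dims: "dim_row X = n" "dim_col X = p" "dim_row V = p" "dim_col V = p" "dim_vec u = p" "dim_vec \<theta> = p"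
    "dim_vec e = n" "dim_row (gram X) = p" "dim_col (gram X) = p"
    using X V e \<theta> u by (auto simp: gram_def)
  have neg: "(V * gram X) *\<^sub>v (u - \<theta>) = - ((V * gram X) *\<^sub>v (\<theta> - u))"
    using A u \<theta> by (subst (1 2) mult_minus_distrib_mat_vec[of _ p p]) auto
  have b: "(1\<^sub>m p - V * gram X) *\<^sub>v (u - \<theta>) = (u - \<theta>) + (V * gram X) *\<^sub>v (\<theta> - u)"
    using A u \<theta> neg by (subst minus_mult_distrib_mat_vec[of _ p p]) auto
  have s: "sqrt (real n) * (1 / real n) = 1 / sqrt (real n)"
    using n by (simp add: real_div_sqrt divide_simps)
  let ?a = "(V * gram X) *\<^sub>v (\<theta> - u)" and ?w = "(V * X\<^sup>T) *\<^sub>v e"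
  have "sqrt (real n) \<cdot>\<^sub>v (u + (?a + (1 / real n) \<cdot>\<^sub>v ?w) - \<theta>) =
      sqrt (real n) \<cdot>\<^sub>v ((u - \<theta>) + ?a) + (1 / sqrt (real n)) \<cdot>\<^sub>v ?w"
  proof (rule eq_vecI)
    fix i assume "i < dim_vec (sqrt (real n) \<cdot>\<^sub>v ((u - \<theta>) + ?a) + (1 / sqrt (real n)) \<cdot>\<^sub>v ?w)"
    then have i: "i < p" using dims by simp
    have "sqrt (real n) * (x + (y + (1 / real n) * z) - t) = sqrt (real n) * ((x - t) + y) + (1 / sqrt (real n)) * z"
      for x y z t :: real
      unfolding s[symmetric] by (simp add: algebra_simps)
    then show "(sqrt (real n) \<cdot>\<^sub>v (u + (?a + (1 / real n) \<cdot>\<^sub>v ?w) - \<theta>)) $ i =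
        (sqrt (real n) \<cdot>\<^sub>v ((u - \<theta>) + ?a) + (1 / sqrt (real n)) \<cdot>\<^sub>v ?w) $ i"
      using i dims by (simp del: index_mult_mat_vec)
  qed (use dims in auto)
  then show ?thesis
    unfolding debiased_est_def bias_term_def noise_term_def u_def[symmetric]
      correction_response[OF X V e \<theta> u] dims b .
qed

text \<open>One coordinate of one round, with \<open>d\<close> the current error, \<open>c\<close> the correction and \<open>s\<close> the bound on
  their distance. If \<open>c\<close> is kept, the new error is \<open>d - c\<close>, below \<open>s\<close>; if it is dropped, the error stays
  \<open>d\<close>, and \<open>\<bar>d\<bar> \<le> \<bar>c\<bar> + s < 2 T\<close>. A coordinate without error has \<open>\<bar>c\<bar> \<le> s < T\<close> and is dropped, so no
  false support is ever created.\<close>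

lemma hard_threshold_step:
  fixes c d s T :: real
  assumes "\<bar>c - d\<bar> \<le> s" "s < T"
  shows "\<bar>d - (if \<bar>c\<bar> \<ge> T then c else 0)\<bar> < 2 * T"
    and "d = 0 \<Longrightarrow> (if \<bar>c\<bar> \<ge> T then c else 0) = 0"
  using assms by (auto split: if_splits)

text \<open>The support invariant keeps the error \<open>K\<close>-sparse, which is what allows the contraction hypothesis to
  be used again in the next round; the bound \<open>2 T\<^sub>t\<close> on the error makes its contribution
  \<open>\<rho> (2 T\<^sub>t)\<close> the first summand of \<open>T\<^sub>t\<^sub>+\<^sub>1\<close>. The inequality has to be strict: a coordinate equal to the
  threshold is kept, and for a degenerate noise (\<open>noise_level = 0\<close>) the noise bound alone leaves no
  slack. Strictness starts from \<open>B < 2 B\<close> and propagates because \<open>\<rho> > 0\<close>.\<close>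

lemma iter_est_error:
  assumes X: "X \<in> carrier_mat n p" and V: "V \<in> carrier_mat p p" and e: "e \<in> carrier_vec n"
    and \<rho>: "0 < \<rho>"
    and contr: "\<And>u. u \<in> sparse_vecs p K \<Longrightarrow> vec_linf ((V * gram X) *\<^sub>v u - u) \<le> \<rho> * vec_linf u"
    and \<theta>: "\<theta> \<in> sparse_vecs p K" "vec_linf \<theta> \<le> B" "0 < B"
    and noise: "vec_linf ((1 / real n) \<cdot>\<^sub>v ((V * X\<^sup>T) *\<^sub>v e)) \<le> noise_level \<delta> V X"
  defines "est \<equiv> iter_est \<rho> \<delta> B V X (response X \<theta> e)"
  shows "(\<forall>i<p. \<theta> $ i = 0 \<longrightarrow> est t $ i = 0) \<and> vec_linf (\<theta> - est t) < 2 * threshold \<rho> \<delta> B V X t"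
proof (induction t)
  case 0
  have \<theta>p: "\<theta> \<in> carrier_vec p" using \<theta> by (auto simp: sparse_vecs_def)
  then have "\<theta> - 0\<^sub>v p = \<theta>" by auto
  then show ?case using X \<theta> by (auto simp: est_def)
next
  case (Suc t)
  have \<theta>p: "\<theta> \<in> carrier_vec p" and c: "card {i. i < p \<and> \<theta> $ i \<noteq> 0} \<le> K"
    using \<theta> by (auto simp: sparse_vecs_def)
  define d where "d = \<theta> - est t"
  define w where "w = (1 / real n) \<cdot>\<^sub>v ((V * X\<^sup>T) *\<^sub>v e)"
  define T where "T = threshold \<rho> \<delta> B V X (Suc t)"
  let ?A = "V * gram X"
  have ep: "est s \<in> carrier_vec p" for s using X V by (simp add: est_def)
  have dp: "d \<in> carrier_vec p" using \<theta>p ep[of t] by (auto simp: d_def)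
  have A: "?A \<in> carrier_mat p p" using V X by (auto intro: mult_carrier_mat)
  have wp: "w \<in> carrier_vec p" using X V e by (auto simp: w_def)
  have dsp: "d \<in> sparse_vecs p K"
  proof -
    have "card {i. i < p \<and> d $ i \<noteq> 0} \<le> card {i. i < p \<and> \<theta> $ i \<noteq> 0}"
      using Suc ep[of t] \<theta>p by (intro card_mono) (auto simp: d_def)
    then show ?thesis using dp c by (auto simp: sparse_vecs_def)
  qed
  have corr: "correction V X (response X \<theta> e) (est t) = ?A *\<^sub>v d + w"
    unfolding d_def w_def by (rule correction_response[OF X V e \<theta>p ep])
  have step: "est (Suc t) $ i = est t $ i +
      (if \<bar>(?A *\<^sub>v d + w) $ i\<bar> \<ge> T then (?A *\<^sub>v d + w) $ i else 0)" if "i < p" for i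
  proof -
    have "est (Suc t) = est t + hard_threshold T (?A *\<^sub>v d + w)"
      unfolding corr[symmetric] by (simp add: est_def T_def)
    then show ?thesis using that A wp dp ep[of t] by (simp add: hard_threshold_def del: index_mult_mat_vec)
  qed
  have lt: "\<rho> * vec_linf d + vec_linf w < T"
  proof -
    have "\<rho> * vec_linf d < \<rho> * (2 * threshold \<rho> \<delta> B V X t)"
      using Suc \<rho> by (intro mult_strict_left_mono) (auto simp: d_def)
    then show ?thesis using noise by (simp add: T_def w_def)
  qed
  have close: "\<bar>(?A *\<^sub>v d + w) $ i - d $ i\<bar> \<le> \<rho> * vec_linf d + vec_linf w" if "i < p" for i
  proof -
    have "\<bar>(?A *\<^sub>v d - d) $ i\<bar> \<le> vec_linf (?A *\<^sub>v d - d)"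
      using that A dp by (intro abs_index_le_vec_linf) auto
    moreover have "\<bar>w $ i\<bar> \<le> vec_linf w"
      using that wp by (intro abs_index_le_vec_linf) auto
    moreover have "(?A *\<^sub>v d + w) $ i - d $ i = (?A *\<^sub>v d - d) $ i + w $ i"
      using that A dp wp by (simp del: index_mult_mat_vec)
    ultimately show ?thesis using contr[OF dsp] by linarith
  qed
  have T0: "0 < T" using lt \<rho> vec_linf_nonneg[of d] vec_linf_nonneg[of w]
    by (smt (verit) mult_nonneg_nonneg)
  have "est (Suc t) $ i = 0" if i: "i < p" "\<theta> $ i = 0" for i
  proof -
    have z: "est t $ i = 0" using Suc i by auto
    then have "d $ i = 0" using i \<theta>p ep[of t] by (auto simp: d_def)
    from hard_threshold_step(2)[OF close[OF i(1)] lt this] z show ?thesis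
      unfolding step[OF i(1)] by simp
  qed
  moreover have "vec_linf (\<theta> - est (Suc t)) < 2 * T"
  proof (subst vec_linf_less_iff, use T0 in simp, intro allI impI)
    fix i assume "i < dim_vec (\<theta> - est (Suc t))"
    then have i: "i < p" using ep[of "Suc t"] by auto
    have "(\<theta> - est (Suc t)) $ i = d $ i - (if \<bar>(?A *\<^sub>v d + w) $ i\<bar> \<ge> T then (?A *\<^sub>v d + w) $ i else 0)"
      using i \<theta>p ep[of t] ep[of "Suc t"] by (simp add: step d_def del: index_add_vec)
    then show "\<bar>(\<theta> - est (Suc t)) $ i\<bar> < 2 * T"
      using hard_threshold_step(1)[OF close[OF i] lt] by simp
  qed
  ultimately show ?case by (simp add: T_def)
qed

lemma threshold_closed_form:
  assumes "2 * \<rho> \<noteq> 1"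
  shows "threshold \<rho> \<delta> B V X t =
     (2 * \<rho>) ^ t * B + noise_level \<delta> V X * ((1 - (2 * \<rho>) ^ t) / (1 - 2 * \<rho>))"
proof (induction t)
  case (Suc t)
  have "1 - 2 * \<rho> \<noteq> 0" using assms by simp
  then have "2 * \<rho> * ((1 - (2 * \<rho>) ^ t) / (1 - 2 * \<rho>)) + 1 = (1 - (2 * \<rho>) ^ Suc t) / (1 - 2 * \<rho>)"
    by (simp add: field_simps)
  then have "noise_level \<delta> V X * ((1 - (2 * \<rho>) ^ Suc t) / (1 - 2 * \<rho>)) =
      2 * \<rho> * (noise_level \<delta> V X * ((1 - (2 * \<rho>) ^ t) / (1 - 2 * \<rho>))) + noise_level \<delta> V X"
    by (metis (no_types, opaque_lifting) distrib_left mult.commute mult.left_commute mult_1_right)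
  then show ?case using Suc by (simp add: algebra_simps)
qed simp

lemma power_num_iter_le:
  assumes "0 < \<rho>" "2 * \<rho> < 1" "0 < n"
  shows "(2 * \<rho>) ^ num_iter \<rho> n \<le> 1 / real n"
proof -
  have l: "0 < ln (1 / (2 * \<rho>))" using assms by simp
  have "ln (real n) / ln (1 / (2 * \<rho>)) \<le> real (num_iter \<rho> n)"
    unfolding num_iter_def by linarith
  then have "ln (real n) \<le> real (num_iter \<rho> n) * ln (1 / (2 * \<rho>))"
    using l by (simp add: divide_le_eq)
  also have "\<dots> = - ln ((2 * \<rho>) ^ num_iter \<rho> n)"
    using assms by (subst ln_realpow) (auto simp: ln_div)
  finally have "ln ((2 * \<rho>) ^ num_iter \<rho> n) \<le> ln (1 / real n)"
    using assms by (simp add: ln_div)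
  then show ?thesis using assms by (subst (asm) ln_le_cancel_iff) auto
qed

lemma noise_term_scaled:
  assumes "X \<in> carrier_mat n p" "0 < n"
  shows "(1 / real n) \<cdot>\<^sub>v ((V * X\<^sup>T) *\<^sub>v e) = (1 / sqrt (real n)) \<cdot>\<^sub>v noise_term V X e"
proof -
  have "dim_row X = n" using assms by auto
  moreover have "1 / sqrt (real n) * (1 / sqrt (real n)) = 1 / real n"
    by simp
  ultimately show ?thesis by (simp only: noise_term_def smult_smult_assoc)
qed

lemma approx_inverse_condD:
  assumes "approx_inverse_cond K r V X" "X \<in> carrier_mat n p" "V \<in> carrier_mat p p"
    and "1 \<le> K" "u \<in> sparse_vecs p K"
  shows "vec_linf ((V * gram X) *\<^sub>v u - u) \<le> r K * vec_linf u"
proof (cases "u = 0\<^sub>v p")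
  case True
  have "V * gram X \<in> carrier_mat p p" using assms(2,3) by (auto intro: mult_carrier_mat)
  then have "(V * gram X) *\<^sub>v 0\<^sub>v p - 0\<^sub>v p = 0\<^sub>v p"
    by (intro eq_vecI) (auto simp: scalar_prod_def)
  then show ?thesis using True by simp
next
  case False
  have u: "u \<in> carrier_vec p" using assms by (auto simp: sparse_vecs_def)
  have "dim_col X = p" using assms by auto
  then have "vec_linf ((V * gram X) *\<^sub>v u - u) / vec_linf u \<le> r K"
    using assms False unfolding approx_inverse_cond_def by auto
  then show ?thesis using vec_linf_pos[OF u False] by (simp add: divide_le_eq)
qed

text \<open>The bias is \<open>\<surd>n\<close> times \<open>V gram X - I\<close> applied to the final error, which costs one more factor
  \<open>r\<^sub>K\<close>. The number of iterations is chosen so that the initial bound \<open>B\<close> has decayed to \<open>B / n\<close>;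
  the factor \<open>\<surd>n\<close> cancels the \<open>1 / \<surd>n\<close> of the noise level.\<close>

lemma bias_term_bound:
  assumes X: "X \<in> carrier_mat n p" and V: "V \<in> carrier_mat p p" and e: "e \<in> carrier_vec n"
    and n: "0 < n" and K: "1 \<le> K" and r: "0 < r K" "2 * r K < 1"
    and cond: "approx_inverse_cond K r V X"
    and \<theta>: "\<theta> \<in> sparse_vecs p K" "vec_linf \<theta> \<le> B" "0 < B"
    and noise: "vec_linf (noise_term V X e) \<le> 2 * sqrt (max_var V X * ln (real p / \<delta>))"
  shows "vec_linf (bias_term (r K) \<delta> B V X (response X \<theta> e) \<theta>)
     \<le> 2 * r K * B / sqrt (real n) + 4 * r K / (1 - 2 * r K) * sqrt (max_var V X * ln (real p / \<delta>))"
proof -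
  define \<rho> where "\<rho> = r K"
  define s where "s = sqrt (max_var V X * ln (real p / \<delta>))"
  define u where "u = thresholding_est \<rho> \<delta> B V X (response X \<theta> e)"
  define N where "N = num_iter \<rho> n"
  have \<rho>: "0 < \<rho>" "2 * \<rho> < 1" using r by (auto simp: \<rho>_def)
  have dims: "dim_row X = n" "dim_col X = p" using X by auto
  have \<theta>p: "\<theta> \<in> carrier_vec p" and c: "card {i. i < p \<and> \<theta> $ i \<noteq> 0} \<le> K"
    using \<theta> by (auto simp: sparse_vecs_def)
  have up: "u \<in> carrier_vec p" using X V by (simp add: u_def thresholding_est_def)
  have level: "noise_level \<delta> V X = 2 * s / sqrt (real n)"
    by (simp add: noise_level_def s_def dims real_sqrt_divide)
  have s0: "0 \<le> s" using noise vec_linf_nonneg[of "noise_term V X e"] unfolding s_def by linarith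
  have "vec_linf ((1 / real n) \<cdot>\<^sub>v ((V * X\<^sup>T) *\<^sub>v e)) \<le> \<bar>1 / sqrt (real n)\<bar> * vec_linf (noise_term V X e)"
    unfolding noise_term_scaled[OF X n] by (rule vec_linf_smult)
  also have "\<dots> \<le> \<bar>1 / sqrt (real n)\<bar> * (2 * s)"
    using noise by (intro mult_left_mono) (auto simp: s_def)
  finally have W: "vec_linf ((1 / real n) \<cdot>\<^sub>v ((V * X\<^sup>T) *\<^sub>v e)) \<le> noise_level \<delta> V X"
    by (simp add: level)
  note err = iter_est_error[OF X V e \<rho>(1) approx_inverse_condD[OF cond X V K, folded \<rho>_def] \<theta> W, of N]
  have u_eq: "u = iter_est \<rho> \<delta> B V X (response X \<theta> e) N"
    by (simp add: u_def thresholding_est_def N_def dims)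
  have supp: "\<theta> - u \<in> sparse_vecs p K"
  proof -
    have "card {i. i < p \<and> (\<theta> - u) $ i \<noteq> 0} \<le> card {i. i < p \<and> \<theta> $ i \<noteq> 0}"
      using err up \<theta>p by (intro card_mono) (auto simp: u_eq)
    then show ?thesis using c up \<theta>p by (auto simp: sparse_vecs_def)
  qed
  have "threshold \<rho> \<delta> B V X N =
      (2 * \<rho>) ^ N * B + noise_level \<delta> V X * ((1 - (2 * \<rho>) ^ N) / (1 - 2 * \<rho>))"
    using \<rho> by (intro threshold_closed_form) simp
  also have "\<dots> \<le> 1 / real n * B + noise_level \<delta> V X * (1 / (1 - 2 * \<rho>))"
  proof (intro add_mono mult_right_mono mult_left_mono divide_right_mono)
    show "(2 * \<rho>) ^ N \<le> 1 / real n" unfolding N_def by (rule power_num_iter_le[OF \<rho> n])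
  qed (use \<rho> \<theta> s0 in \<open>auto simp: level\<close>)
  finally have T: "threshold \<rho> \<delta> B V X N \<le> B / real n + noise_level \<delta> V X / (1 - 2 * \<rho>)" by simp
  have A: "V * gram X \<in> carrier_mat p p" using V X by (auto intro: mult_carrier_mat)
  have b: "(1\<^sub>m p - V * gram X) *\<^sub>v (u - \<theta>) = (V * gram X) *\<^sub>v (\<theta> - u) - (\<theta> - u)"
  proof -
    have neg: "(V * gram X) *\<^sub>v (u - \<theta>) = - ((V * gram X) *\<^sub>v (\<theta> - u))"
      using A up \<theta>p by (subst (1 2) mult_minus_distrib_mat_vec[of _ p p]) auto
    show ?thesis
      using A up \<theta>p neg
      by (subst minus_mult_distrib_mat_vec[of _ p p])
        (auto intro!: eq_vecI simp del: index_mult_mat_vec)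
  qed
  have "vec_linf (bias_term \<rho> \<delta> B V X (response X \<theta> e) \<theta>) \<le>
      \<bar>sqrt (real n)\<bar> * vec_linf ((V * gram X) *\<^sub>v (\<theta> - u) - (\<theta> - u))"
    unfolding bias_term_def u_def[symmetric] dims b by (rule vec_linf_smult)
  also have "\<dots> \<le> \<bar>sqrt (real n)\<bar> * (\<rho> * vec_linf (\<theta> - u))"
    unfolding \<rho>_def by (intro mult_left_mono approx_inverse_condD[OF cond X V K supp]) auto
  also have "\<dots> \<le> \<bar>sqrt (real n)\<bar> * (\<rho> * (2 * (B / real n + noise_level \<delta> V X / (1 - 2 * \<rho>))))"
    using err T \<rho> by (intro mult_left_mono) (auto simp: u_eq)
  also have "\<dots> = 2 * \<rho> * (B * (sqrt (real n) / real n)) + 4 * \<rho> / (1 - 2 * \<rho>) * s"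
    unfolding level using n \<rho> by (simp add: field_simps)
  also have "sqrt (real n) / real n = 1 / sqrt (real n)"
    using n by (simp add: real_div_sqrt divide_simps)
  finally show ?thesis by (simp add: \<rho>_def s_def)
qed

section \<open>Measurability of vector- and matrix-valued maps\<close>

lemma space_vec_borel [simp]: "space (vec_borel n) = carrier_vec n"
  by (simp add: vec_borel_def)

lemma space_mat_borel [simp]: "space (mat_borel n p) = carrier_mat n p"
  by (simp add: mat_borel_def)

lemma measurable_vec_index:
  assumes "i < n"
  shows "(\<lambda>v. v $ i) \<in> borel_measurable (vec_borel n)"
proof -
  have "(\<lambda>v. \<lambda>i\<in>{..<n}. v $ i) \<in> vec_borel n \<rightarrow>\<^sub>M (\<Pi>\<^sub>M i\<in>{..<n}. borel)"
    unfolding vec_borel_def by (rule measurable_vimage_algebra1) (auto simp: space_PiM)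
  from measurable_compose[OF this measurable_component_singleton[of i]] assms show ?thesis by simp
qed

lemma measurable_mat_index:
  assumes "i < n" "j < p"
  shows "(\<lambda>A. A $$ (i, j)) \<in> borel_measurable (mat_borel n p)"
proof -
  have "(\<lambda>A. \<lambda>ij\<in>{..<n} \<times> {..<p}. A $$ ij) \<in> mat_borel n p \<rightarrow>\<^sub>M (\<Pi>\<^sub>M ij\<in>{..<n} \<times> {..<p}. borel)"
    unfolding mat_borel_def by (rule measurable_vimage_algebra1) (auto simp: space_PiM)
  from measurable_compose[OF this measurable_component_singleton[of "(i, j)"]] assms show ?thesis by simp
qed

lemma measurable_vec_borel_iff:
  "f \<in> M \<rightarrow>\<^sub>M vec_borel n \<longleftrightarrow>
     (\<forall>x\<in>space M. f x \<in> carrier_vec n) \<and> (\<forall>i<n. (\<lambda>x. f x $ i) \<in> borel_measurable M)"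
proof safe
  assume f: "f \<in> M \<rightarrow>\<^sub>M vec_borel n"
  show "f x \<in> carrier_vec n" if "x \<in> space M" for x using measurable_space[OF f that] by simp
  show "(\<lambda>x. f x $ i) \<in> borel_measurable M" if "i < n" for i
    using measurable_compose[OF f measurable_vec_index[OF that]] .
next
  assume "\<forall>x\<in>space M. f x \<in> carrier_vec n" "\<forall>i<n. (\<lambda>x. f x $ i) \<in> borel_measurable M"
  then show "f \<in> M \<rightarrow>\<^sub>M vec_borel n"
    unfolding vec_borel_def by (intro measurable_vimage_algebra2 measurable_restrict) auto
qed

lemma measurable_mat_borel_iff:
  "f \<in> M \<rightarrow>\<^sub>M mat_borel n p \<longleftrightarrow>
     (\<forall>x\<in>space M. f x \<in> carrier_mat n p) \<and>
     (\<forall>i<n. \<forall>j<p. (\<lambda>x. f x $$ (i, j)) \<in> borel_measurable M)"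
proof safe
  assume f: "f \<in> M \<rightarrow>\<^sub>M mat_borel n p"
  show "f x \<in> carrier_mat n p" if "x \<in> space M" for x using measurable_space[OF f that] by simp
  show "(\<lambda>x. f x $$ (i, j)) \<in> borel_measurable M" if "i < n" "j < p" for i j
    using measurable_compose[OF f measurable_mat_index[OF that]] .
next
  assume "\<forall>x\<in>space M. f x \<in> carrier_mat n p" "\<forall>i<n. \<forall>j<p. (\<lambda>x. f x $$ (i, j)) \<in> borel_measurable M"
  then show "f \<in> M \<rightarrow>\<^sub>M mat_borel n p"
    unfolding mat_borel_def by (intro measurable_vimage_algebra2 measurable_restrict) auto
qed

lemma measurable_vecI:
  assumes "\<And>x. x \<in> space M \<Longrightarrow> f x \<in> carrier_vec n"
    and "\<And>x i. x \<in> space M \<Longrightarrow> i < n \<Longrightarrow> f x $ i = g i x"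
    and "\<And>i. i < n \<Longrightarrow> g i \<in> borel_measurable M"
  shows "f \<in> M \<rightarrow>\<^sub>M vec_borel n"
  unfolding measurable_vec_borel_iff
  using assms by (auto cong: measurable_cong)

lemma measurable_matI:
  assumes "\<And>x. x \<in> space M \<Longrightarrow> f x \<in> carrier_mat n p"
    and "\<And>x i j. x \<in> space M \<Longrightarrow> i < n \<Longrightarrow> j < p \<Longrightarrow> f x $$ (i, j) = g i j x"
    and "\<And>i j. i < n \<Longrightarrow> j < p \<Longrightarrow> g i j \<in> borel_measurable M"
  shows "f \<in> M \<rightarrow>\<^sub>M mat_borel n p"
  unfolding measurable_mat_borel_iff
  using assms by (auto cong: measurable_cong)

named_theorems vec_meas \<open>closure of the measurable vector- and matrix-valued maps\<close>

lemma measurable_mult_mat_vec [vec_meas]: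
  assumes f: "f \<in> M \<rightarrow>\<^sub>M mat_borel n p" and g: "g \<in> M \<rightarrow>\<^sub>M vec_borel p"
  shows "(\<lambda>x. f x *\<^sub>v g x) \<in> M \<rightarrow>\<^sub>M vec_borel n"
proof (rule measurable_vecI[where g="\<lambda>i x. \<Sum>l = 0..<p. f x $$ (i, l) * g x $ l"])
  fix x i assume "x \<in> space M" "i < n"
  then have "f x \<in> carrier_mat n p" "g x \<in> carrier_vec p" "i < n"
    using f g by (auto simp: measurable_mat_borel_iff measurable_vec_borel_iff)
  then show "(f x *\<^sub>v g x) $ i = (\<Sum>l = 0..<p. f x $$ (i, l) * g x $ l)"
    by (auto simp: scalar_prod_def)
qed (use f g in \<open>auto simp: measurable_mat_borel_iff measurable_vec_borel_iff
    intro!: borel_measurable_sum borel_measurable_times mult_mat_vec_carrier\<close>)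

lemma measurable_mult_mat [vec_meas]:
  assumes f: "f \<in> M \<rightarrow>\<^sub>M mat_borel n p" and g: "g \<in> M \<rightarrow>\<^sub>M mat_borel p q"
  shows "(\<lambda>x. f x * g x) \<in> M \<rightarrow>\<^sub>M mat_borel n q"
proof (rule measurable_matI[where g="\<lambda>i j x. \<Sum>l = 0..<p. f x $$ (i, l) * g x $$ (l, j)"])
  fix x i j assume "x \<in> space M" "i < n" "j < q"
  then have "f x \<in> carrier_mat n p" "g x \<in> carrier_mat p q" "i < n" "j < q"
    using f g by (auto simp: measurable_mat_borel_iff)
  then show "(f x * g x) $$ (i, j) = (\<Sum>l = 0..<p. f x $$ (i, l) * g x $$ (l, j))"
    by (auto simp: scalar_prod_def)
qed (use f g in \<open>auto simp: measurable_mat_borel_iff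
    intro!: borel_measurable_sum borel_measurable_times mult_carrier_mat\<close>)

lemma measurable_transpose_mat [vec_meas]:
  assumes f: "f \<in> M \<rightarrow>\<^sub>M mat_borel n p"
  shows "(\<lambda>x. (f x)\<^sup>T) \<in> M \<rightarrow>\<^sub>M mat_borel p n"
  using f by (intro measurable_matI[where g="\<lambda>i j x. f x $$ (j, i)"])
    (auto simp: measurable_mat_borel_iff)

lemma measurable_smult_vec [vec_meas]:
  assumes f: "f \<in> M \<rightarrow>\<^sub>M vec_borel n"
  shows "(\<lambda>x. c \<cdot>\<^sub>v f x) \<in> M \<rightarrow>\<^sub>M vec_borel n"
  using f by (intro measurable_vecI[where g="\<lambda>i x. c * f x $ i"])
    (auto simp: measurable_vec_borel_iff)

lemma measurable_add_vec [vec_meas]: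
  assumes f: "f \<in> M \<rightarrow>\<^sub>M vec_borel n" and g: "g \<in> M \<rightarrow>\<^sub>M vec_borel n"
  shows "(\<lambda>x. f x + g x) \<in> M \<rightarrow>\<^sub>M vec_borel n"
  using f g by (intro measurable_vecI[where g="\<lambda>i x. f x $ i + g x $ i"])
    (auto simp: measurable_vec_borel_iff intro!: borel_measurable_add)

lemma measurable_diff_vec [vec_meas]:
  assumes f: "f \<in> M \<rightarrow>\<^sub>M vec_borel n" and g: "g \<in> M \<rightarrow>\<^sub>M vec_borel n"
  shows "(\<lambda>x. f x - g x) \<in> M \<rightarrow>\<^sub>M vec_borel n"
  using f g by (intro measurable_vecI[where g="\<lambda>i x. f x $ i - g x $ i"])
    (auto simp: measurable_vec_borel_iff intro!: borel_measurable_diff)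

lemma measurable_diff_mat [vec_meas]:
  assumes f: "f \<in> M \<rightarrow>\<^sub>M mat_borel n p" and g: "g \<in> M \<rightarrow>\<^sub>M mat_borel n p"
  shows "(\<lambda>x. f x - g x) \<in> M \<rightarrow>\<^sub>M mat_borel n p"
  using f g by (intro measurable_matI[where g="\<lambda>i j x. f x $$ (i, j) - g x $$ (i, j)"])
    (auto simp: measurable_mat_borel_iff intro!: borel_measurable_diff minus_carrier_mat)

lemma measurable_const_vec [vec_meas]: "v \<in> carrier_vec n \<Longrightarrow> (\<lambda>x. v) \<in> M \<rightarrow>\<^sub>M vec_borel n"
  by (auto simp: measurable_vec_borel_iff)

lemma measurable_const_mat [vec_meas]: "A \<in> carrier_mat n p \<Longrightarrow> (\<lambda>x. A) \<in> M \<rightarrow>\<^sub>M mat_borel n p"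
  by (auto simp: measurable_mat_borel_iff)

lemma measurable_gram [vec_meas]:
  assumes f: "f \<in> M \<rightarrow>\<^sub>M mat_borel n p"
  shows "(\<lambda>x. gram (f x)) \<in> M \<rightarrow>\<^sub>M mat_borel p p"
proof -
  have h: "(\<lambda>x. (f x)\<^sup>T * f x) \<in> M \<rightarrow>\<^sub>M mat_borel p p"
    using f by (intro vec_meas)
  show ?thesis
    by (rule measurable_matI[where g="\<lambda>i j x. (1 / real n) * ((f x)\<^sup>T * f x) $$ (i, j)"])
      (use f h in \<open>auto simp: measurable_mat_borel_iff gram_def
        intro!: borel_measurable_divide simp del: index_mult_mat(1)\<close>)
qed

lemma measurable_hard_threshold [vec_meas]:
  assumes f: "f \<in> M \<rightarrow>\<^sub>M vec_borel n" and t[measurable]: "t \<in> borel_measurable M"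
  shows "(\<lambda>x. hard_threshold (t x) (f x)) \<in> M \<rightarrow>\<^sub>M vec_borel n"
proof (rule measurable_vecI[where g="\<lambda>i x. if t x \<le> \<bar>f x $ i\<bar> then f x $ i else 0"])
  fix i assume "i < n"
  then have [measurable]: "(\<lambda>x. f x $ i) \<in> borel_measurable M"
    using f by (auto simp: measurable_vec_borel_iff)
  show "(\<lambda>x. if t x \<le> \<bar>f x $ i\<bar> then f x $ i else 0) \<in> borel_measurable M"
    by measurable
qed (use f in \<open>auto simp: hard_threshold_def measurable_vec_borel_iff\<close>)

lemma measurable_vec_linf:
  assumes f: "f \<in> M \<rightarrow>\<^sub>M vec_borel n"
  shows "(\<lambda>x. vec_linf (f x)) \<in> borel_measurable M"
proof -
  have "(\<lambda>x. Max ((\<lambda>i. if i < n then \<bar>f x $ i\<bar> else 0) ` {..n})) \<in> borel_measurable M"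
  proof (rule borel_measurable_Max)
    show "(\<lambda>x. if i < n then \<bar>f x $ i\<bar> else 0) \<in> borel_measurable M" for i
      using f by (cases "i < n") (auto simp: measurable_vec_borel_iff)
  qed simp
  moreover have "vec_linf (f x) = Max ((\<lambda>i. if i < n then \<bar>f x $ i\<bar> else 0) ` {..n})"
    if "x \<in> space M" for x
  proof -
    have "dim_vec (f x) = n" using f that by (auto simp: measurable_vec_borel_iff)
    moreover have "(\<lambda>i. if i < n then \<bar>f x $ i\<bar> else 0) ` {..<n} = (\<lambda>i. \<bar>f x $ i\<bar>) ` {..<n}"
      by (rule image_cong) auto
    moreover have "{..n} = insert n {..<n}" by auto
    ultimately show ?thesis by (simp only: vec_linf_def image_insert less_irrefl if_False)
  qed
  ultimately show ?thesis by (simp cong: measurable_cong)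
qed

lemma max_var_eq:
  assumes "X \<in> carrier_mat n p" "V \<in> carrier_mat p p"
  shows "max_var V X = Max ((\<lambda>i. (V * gram X * V\<^sup>T) $$ (i, i)) ` {..<p})"
proof -
  have "set (diag_mat (V * gram X * V\<^sup>T)) = (\<lambda>i. (V * gram X * V\<^sup>T) $$ (i, i)) ` {..<p}"
    using assms unfolding diag_mat_def by auto
  then show ?thesis by (simp add: max_var_def)
qed

lemma measurable_max_var:
  assumes f: "f \<in> M \<rightarrow>\<^sub>M mat_borel n p" and g: "g \<in> M \<rightarrow>\<^sub>M mat_borel p p"
  shows "(\<lambda>x. max_var (g x) (f x)) \<in> borel_measurable M"
proof -
  have h: "(\<lambda>x. g x * gram (f x) * (g x)\<^sup>T) \<in> M \<rightarrow>\<^sub>M mat_borel p p"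
    by (rule measurable_mult_mat[OF measurable_mult_mat[OF g measurable_gram[OF f]]
          measurable_transpose_mat[OF g]])
  have "(\<lambda>x. Max ((\<lambda>i. (g x * gram (f x) * (g x)\<^sup>T) $$ (i, i)) ` {..<p})) \<in> borel_measurable M"
    using h by (intro borel_measurable_Max) (auto simp: measurable_mat_borel_iff)
  moreover have "max_var (g x) (f x) = Max ((\<lambda>i. (g x * gram (f x) * (g x)\<^sup>T) $$ (i, i)) ` {..<p})"
    if "x \<in> space M" for x
    using f g that by (intro max_var_eq) (auto simp: measurable_mat_borel_iff)
  ultimately show ?thesis by (simp cong: measurable_cong)
qed

lemma measurable_noise_term [vec_meas]:
  assumes f: "f \<in> M \<rightarrow>\<^sub>M mat_borel n p" and g: "g \<in> M \<rightarrow>\<^sub>M mat_borel p p"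
    and e: "e \<in> M \<rightarrow>\<^sub>M vec_borel n"
  shows "(\<lambda>x. noise_term (g x) (f x) (e x)) \<in> M \<rightarrow>\<^sub>M vec_borel p"
proof -
  have h: "(\<lambda>x. (1 / sqrt (real n)) \<cdot>\<^sub>v ((g x * (f x)\<^sup>T) *\<^sub>v e x)) \<in> M \<rightarrow>\<^sub>M vec_borel p"
    using f g e by (intro vec_meas)
  have "noise_term (g x) (f x) (e x) = (1 / sqrt (real n)) \<cdot>\<^sub>v ((g x * (f x)\<^sup>T) *\<^sub>v e x)"
    if "x \<in> space M" for x
    using f that by (auto simp: noise_term_def measurable_mat_borel_iff)
  with h show ?thesis by (simp cong: measurable_cong)
qed

lemma measurable_bias_term [vec_meas]:
  assumes f: "f \<in> M \<rightarrow>\<^sub>M mat_borel n p" and g: "g \<in> M \<rightarrow>\<^sub>M mat_borel p p"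
    and y: "y \<in> M \<rightarrow>\<^sub>M vec_borel n" and \<theta>: "\<theta> \<in> carrier_vec p"
  shows "(\<lambda>x. bias_term \<rho> \<delta> B (g x) (f x) (y x) \<theta>) \<in> M \<rightarrow>\<^sub>M vec_borel p"
proof -
  have dims: "dim_row (f x) = n" "dim_col (f x) = p" if "x \<in> space M" for x
    using f that by (auto simp: measurable_mat_borel_iff)
  have level: "(\<lambda>x. noise_level \<delta> (g x) (f x)) \<in> borel_measurable M"
  proof -
    have [measurable]: "(\<lambda>x. max_var (g x) (f x)) \<in> borel_measurable M"
      by (rule measurable_max_var[OF f g])
    have "(\<lambda>x. 2 * sqrt (max_var (g x) (f x) * ln (real p / \<delta>) / real n)) \<in> borel_measurable M"
      by measurable
    then show ?thesis by (simp add: noise_level_def dims cong: measurable_cong)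
  qed
  have thr: "(\<lambda>x. threshold \<rho> \<delta> B (g x) (f x) t) \<in> borel_measurable M" for t
    by (induction t) (use level in auto)
  have corr: "(\<lambda>x. correction (g x) (f x) (y x) (u x)) \<in> M \<rightarrow>\<^sub>M vec_borel p"
    if u: "u \<in> M \<rightarrow>\<^sub>M vec_borel p" for u
  proof -
    have "(\<lambda>x. (1 / real n) \<cdot>\<^sub>v ((g x * (f x)\<^sup>T) *\<^sub>v (y x - f x *\<^sub>v u x))) \<in> M \<rightarrow>\<^sub>M vec_borel p"
      using f g y u by (intro vec_meas)
    then show ?thesis by (simp add: correction_def dims cong: measurable_cong)
  qed
  have iter: "(\<lambda>x. iter_est \<rho> \<delta> B (g x) (f x) (y x) t) \<in> M \<rightarrow>\<^sub>M vec_borel p" for t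
  proof (induction t)
    case 0
    have "(\<lambda>x. 0\<^sub>v p) \<in> M \<rightarrow>\<^sub>M vec_borel p" by (intro vec_meas) auto
    then show ?case by (simp add: dims cong: measurable_cong)
  next
    case (Suc t)
    then show ?case
      unfolding iter_est.simps by (intro vec_meas corr thr)
  qed
  have "(\<lambda>x. sqrt (real n) \<cdot>\<^sub>v ((1\<^sub>m p - g x * gram (f x)) *\<^sub>v
      (iter_est \<rho> \<delta> B (g x) (f x) (y x) (num_iter \<rho> n) - \<theta>))) \<in> M \<rightarrow>\<^sub>M vec_borel p"
    by (intro measurable_smult_vec measurable_mult_mat_vec[where p=p] measurable_diff_mat measurable_diff_vec
        iter measurable_const_vec[OF \<theta>] measurable_const_mat one_carrier_mat
        measurable_mult_mat[OF g measurable_gram[OF f]])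
  then show ?thesis by (simp add: bias_term_def thresholding_est_def dims cong: measurable_cong)
qed

section \<open>Gaussian vectors\<close>

text \<open>Chernoff bound through a comparison of densities: beyond \<open>2 \<surd>(v L)\<close> the density of \<open>N(0, v)\<close> is at
  most \<open>2 exp (-3 L / 2)\<close> times that of \<open>N(0, 4 v)\<close>, whose total mass is 1. The exponent must exceed \<open>L\<close>
  because a union bound over \<open>p\<close> coordinates with \<open>L \<ge> ln p\<close> follows; the optimal exponent would be \<open>2 L\<close>.
  For \<open>v = 0\<close> the law is a point mass outside the set.\<close>

lemma normal_law_tail:
  assumes v: "0 \<le> v" "v \<le> M" and L: "0 \<le> L"
  shows "emeasure (normal_law 0 v) {x. 2 * sqrt (M * L) < \<bar>x\<bar>} \<le> ennreal (2 * exp (- (3 / 2) * L))"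
proof (cases "v = 0")
  case True
  then have "emeasure (normal_law 0 v) {x. 2 * sqrt (M * L) < \<bar>x\<bar>} = 0"
    using v L by (simp add: normal_law_def indicator_def not_less mult_nonneg_nonneg)
  then show ?thesis by simp
next
  case False
  with v have v0: "0 < v" by simp
  define c where "c = 2 * exp (- (3 / 2) * L)"
  let ?A = "{x. 2 * sqrt (M * L) < \<bar>x\<bar>}"
  have bound: "normal_density 0 (sqrt v) x \<le> c * normal_density 0 (2 * sqrt v) x" if "x \<in> ?A" for x
  proof -
    have "2 * sqrt (v * L) \<le> 2 * sqrt (M * L)" using v L by (intro mult_left_mono real_sqrt_le_mono mult_right_mono) auto
    also have "\<dots> \<le> \<bar>x\<bar>" using that by simp
    finally have "(2 * sqrt (v * L))\<^sup>2 \<le> \<bar>x\<bar>\<^sup>2" using v L by (intro power_mono) auto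
    then have "4 * (v * L) \<le> x\<^sup>2" using v L by (simp add: power_mult_distrib)
    then have "- x\<^sup>2 / (2 * v) \<le> - (3 / 2) * L + (- x\<^sup>2 / (8 * v))"
      using v0 by (simp add: field_simps)
    then have "exp (- x\<^sup>2 / (2 * v)) \<le> exp (- (3 / 2) * L) * exp (- x\<^sup>2 / (8 * v))"
      unfolding exp_add[symmetric] by simp
    then have "1 / sqrt (2 * pi * v) * exp (- x\<^sup>2 / (2 * v)) \<le>
        1 / sqrt (2 * pi * v) * (exp (- (3 / 2) * L) * exp (- x\<^sup>2 / (8 * v)))"
      using v0 by (intro mult_left_mono) auto
    also have "\<dots> = c * (1 / (2 * sqrt (2 * pi * v)) * exp (- x\<^sup>2 / (8 * v)))"
      by (simp add: c_def)
    also have "2 * sqrt (2 * pi * v) = sqrt (2 * pi * (4 * v))"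
      using real_sqrt_mult[of 4 "2 * pi * v"] by (simp add: mult_ac)
    finally show ?thesis
      using v0 by (simp add: normal_density_def power_mult_distrib)
  qed
  have "emeasure (normal_law 0 v) ?A = (\<integral>\<^sup>+x. ennreal (normal_density 0 (sqrt v) x) * indicator ?A x \<partial>lborel)"
    using False by (simp add: normal_law_def emeasure_density)
  also have "\<dots> \<le> (\<integral>\<^sup>+x. ennreal c * ennreal (normal_density 0 (2 * sqrt v) x) \<partial>lborel)"
    using bound by (intro nn_integral_mono)
      (auto simp: indicator_def ennreal_mult[symmetric] c_def intro!: ennreal_leI)
  also have "\<dots> = ennreal c * (\<integral>\<^sup>+x. ennreal (normal_density 0 (2 * sqrt v) x) \<partial>lborel)"
    by (intro nn_integral_cmult) auto
  also have "(\<integral>\<^sup>+x. ennreal (normal_density 0 (2 * sqrt v) x) \<partial>lborel) = 1"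
    using prob_space.emeasure_space_1[OF prob_space_normal_density[of "2 * sqrt v" 0]] v0
    by (simp add: emeasure_density)
  finally show ?thesis by (simp add: c_def)
qed

lemma measurable_scalar_prod:
  assumes "a \<in> carrier_vec d"
  shows "(\<lambda>v. scalar_prod a v) \<in> borel_measurable (vec_borel d)"
proof -
  have "(\<lambda>v. \<Sum>i = 0..<d. a $ i * v $ i) \<in> borel_measurable (vec_borel d)"
    by (intro borel_measurable_sum borel_measurable_times measurable_vec_index) auto
  moreover have "scalar_prod a v = (\<Sum>i = 0..<d. a $ i * v $ i)" if "v \<in> space (vec_borel d)" for v
    using that by (auto simp: scalar_prod_def)
  ultimately show ?thesis by (subst measurable_cong) auto
qed

text \<open>By the adjoint identity \<open>a \<cdot> A e = A\<^sup>T a \<cdot> e\<close>, every linear functional of \<open>A e\<close> is one of \<open>e\<close>.\<close>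

lemma mv_normal_linear_image:
  assumes \<nu>: "mv_normal n \<mu> S \<nu>" and A: "A \<in> carrier_mat p n"
  shows "mv_normal p (A *\<^sub>v \<mu>) (A * S * A\<^sup>T) (distr \<nu> (vec_borel p) (\<lambda>e. A *\<^sub>v e))"
proof -
  have \<mu>: "\<mu> \<in> carrier_vec n" and S: "S \<in> carrier_mat n n" and ps: "prob_space \<nu>"
    and sets[measurable_cong]: "sets \<nu> = sets (vec_borel n)"
    and lin: "\<And>a. a \<in> carrier_vec n \<Longrightarrow> distr \<nu> borel (\<lambda>v. scalar_prod a v) =
        normal_law (scalar_prod a \<mu>) (scalar_prod a (S *\<^sub>v a))"
    using \<nu> by (auto simp: mv_normal_def)
  have sp: "space \<nu> = carrier_vec n" using sets_eq_imp_space_eq[OF sets] by simp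
  have meas: "(\<lambda>e. A *\<^sub>v e) \<in> \<nu> \<rightarrow>\<^sub>M vec_borel p"
    using A measurable_ident_sets[OF sets] by (intro vec_meas) auto
  have adj: "scalar_prod a (A *\<^sub>v e) = scalar_prod (A\<^sup>T *\<^sub>v a) e"
    if "a \<in> carrier_vec p" "e \<in> carrier_vec n" for a e
    using transpose_vec_mult_scalar[OF A that(2,1)] by simp
  show ?thesis
    unfolding mv_normal_def
  proof (intro conjI ballI)
    fix a :: "real vec" assume a: "a \<in> carrier_vec p"
    have At: "A\<^sup>T *\<^sub>v a \<in> carrier_vec n" using A a by auto
    have "distr (distr \<nu> (vec_borel p) (\<lambda>e. A *\<^sub>v e)) borel (\<lambda>v. scalar_prod a v) =
        distr \<nu> borel (\<lambda>e. scalar_prod a (A *\<^sub>v e))"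
      using distr_distr[OF measurable_scalar_prod[OF a] meas] by (simp add: comp_def)
    also have "\<dots> = distr \<nu> borel (\<lambda>e. scalar_prod (A\<^sup>T *\<^sub>v a) e)"
      by (intro distr_cong) (auto simp: sp adj[OF a])
    also have "\<dots> = normal_law (scalar_prod (A\<^sup>T *\<^sub>v a) \<mu>) (scalar_prod (A\<^sup>T *\<^sub>v a) (S *\<^sub>v (A\<^sup>T *\<^sub>v a)))"
      by (rule lin[OF At])
    also have "scalar_prod (A\<^sup>T *\<^sub>v a) \<mu> = scalar_prod a (A *\<^sub>v \<mu>)"
      by (rule adj[symmetric]) (use a \<mu> in auto)
    also have "scalar_prod (A\<^sup>T *\<^sub>v a) (S *\<^sub>v (A\<^sup>T *\<^sub>v a)) = scalar_prod a (A *\<^sub>v (S *\<^sub>v (A\<^sup>T *\<^sub>v a)))"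
      by (rule adj[symmetric]) (use a At S in auto)
    also have "A *\<^sub>v (S *\<^sub>v (A\<^sup>T *\<^sub>v a)) = (A * S * A\<^sup>T) *\<^sub>v a"
    proof -
      have "(A * S * A\<^sup>T) *\<^sub>v a = (A * S) *\<^sub>v (A\<^sup>T *\<^sub>v a)"
        by (rule assoc_mult_mat_vec[of _ p n _ p]) (use A S a in auto)
      also have "\<dots> = A *\<^sub>v (S *\<^sub>v (A\<^sup>T *\<^sub>v a))"
        by (rule assoc_mult_mat_vec[of _ p n _ n]) (use A S At in auto)
      finally show ?thesis by simp
    qed
    finally show "distr (distr \<nu> (vec_borel p) (\<lambda>e. A *\<^sub>v e)) borel (\<lambda>v. scalar_prod a v) =
        normal_law (scalar_prod a (A *\<^sub>v \<mu>)) (scalar_prod a (A * S * A\<^sup>T *\<^sub>v a))" .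
  qed (use A S \<mu> meas ps in \<open>auto intro: prob_space.prob_space_distr\<close>)
qed

lemma mv_normal_linf_tail:
  assumes \<nu>: "mv_normal d (0\<^sub>v d) S \<nu>" and S: "\<And>i. i < d \<Longrightarrow> 0 \<le> S $$ (i, i) \<and> S $$ (i, i) \<le> M"
    and M: "0 \<le> M" and L: "0 \<le> L"
  shows "emeasure \<nu> {v \<in> space \<nu>. 2 * sqrt (M * L) < vec_linf v} \<le> ennreal (real d * (2 * exp (- (3 / 2) * L)))"
proof -
  have Sc: "S \<in> carrier_mat d d" and ps: "prob_space \<nu>"
    and sets[measurable_cong]: "sets \<nu> = sets (vec_borel d)"
    and lin: "\<And>a. a \<in> carrier_vec d \<Longrightarrow> distr \<nu> borel (\<lambda>v. scalar_prod a v) =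
        normal_law (scalar_prod a (0\<^sub>v d)) (scalar_prod a (S *\<^sub>v a))"
    using \<nu> by (auto simp: mv_normal_def)
  have sp: "space \<nu> = carrier_vec d" using sets_eq_imp_space_eq[OF sets] by simp
  let ?E = "\<lambda>i. {v \<in> space \<nu>. 2 * sqrt (M * L) < \<bar>v $ i\<bar>}"
  have idx: "(\<lambda>v. v $ i) \<in> borel_measurable \<nu>" if "i < d" for i
    using measurable_vec_index[OF that] by (simp cong: measurable_cong_sets add: sets)
  have E: "?E i \<in> sets \<nu>" if "i < d" for i
  proof -
    note [measurable] = idx[OF that]
    show ?thesis by measurable
  qed
  have tail: "emeasure \<nu> (?E i) \<le> ennreal (2 * exp (- (3 / 2) * L))" if i: "i < d" for i
  proof -
    have "emeasure \<nu> (?E i) = emeasure (distr \<nu> borel (\<lambda>v. v $ i)) {x. 2 * sqrt (M * L) < \<bar>x\<bar>}"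
      by (subst emeasure_distr[OF idx[OF i]]) (auto intro!: arg_cong[where f="emeasure \<nu>"])
    also have "distr \<nu> borel (\<lambda>v. v $ i) = distr \<nu> borel (\<lambda>v. scalar_prod (unit_vec d i) v)"
      by (intro distr_cong) (use i in \<open>auto simp: sp scalar_prod_left_unit\<close>)
    also have "\<dots> = normal_law 0 (S $$ (i, i))"
    proof -
      have "S *\<^sub>v unit_vec d i \<in> carrier_vec d" using Sc by auto
      then have "scalar_prod (unit_vec d i) (S *\<^sub>v unit_vec d i) = (S *\<^sub>v unit_vec d i) $ i"
        using i by (rule scalar_prod_left_unit)
      also have "\<dots> = S $$ (i, i)" using i Sc by auto
      finally show ?thesis using i by (subst lin) auto
    qed
    also have "emeasure \<dots> {x. 2 * sqrt (M * L) < \<bar>x\<bar>} \<le> ennreal (2 * exp (- (3 / 2) * L))"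
      using S[OF i] L by (intro normal_law_tail) auto
    finally show ?thesis .
  qed
  have "{v \<in> space \<nu>. 2 * sqrt (M * L) < vec_linf v} \<subseteq> (\<Union>i<d. ?E i)"
  proof (rule subsetI, rule ccontr)
    fix v assume v: "v \<in> {v \<in> space \<nu>. 2 * sqrt (M * L) < vec_linf v}" and "v \<notin> (\<Union>i<d. ?E i)"
    then have "\<forall>i<dim_vec v. \<bar>v $ i\<bar> \<le> 2 * sqrt (M * L)" by (auto simp: sp not_less)
    then have "vec_linf v \<le> 2 * sqrt (M * L)" using M L by (subst vec_linf_le_iff) auto
    then show False using v by simp
  qed
  then have "emeasure \<nu> {v \<in> space \<nu>. 2 * sqrt (M * L) < vec_linf v} \<le> emeasure \<nu> (\<Union>i<d. ?E i)"
    using E by (intro emeasure_mono) auto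
  also have "\<dots> \<le> (\<Sum>i<d. emeasure \<nu> (?E i))"
    using E by (intro emeasure_subadditive_finite) auto
  also have "\<dots> \<le> (\<Sum>i<d. ennreal (2 * exp (- (3 / 2) * L)))"
    using tail by (intro sum_mono) auto
  also have "\<dots> = ennreal (\<Sum>i<d. 2 * exp (- (3 / 2) * L))"
    by (rule sum_ennreal) simp
  finally show ?thesis by simp
qed

lemma noise_covariance:
  assumes X: "X \<in> carrier_mat n p" and V: "V \<in> carrier_mat p p"
  defines "A \<equiv> (1 / sqrt (real n)) \<cdot>\<^sub>m (V * X\<^sup>T)"
  shows "A * 1\<^sub>m n * A\<^sup>T = V * gram X * V\<^sup>T"
proof -
  have Xt: "X\<^sup>T \<in> carrier_mat p n" and Vt: "V\<^sup>T \<in> carrier_mat p p" and VX: "V * X\<^sup>T \<in> carrier_mat p n"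
    and G: "X\<^sup>T * X \<in> carrier_mat p p" and dX: "dim_row X = n"
    using X V by auto
  have A: "A \<in> carrier_mat p n" unfolding A_def using VX by auto
  have "A\<^sup>T = (1 / sqrt (real n)) \<cdot>\<^sub>m (V * X\<^sup>T)\<^sup>T"
    unfolding A_def by (rule eq_matI) auto
  also have "(V * X\<^sup>T)\<^sup>T = X * V\<^sup>T"
    using transpose_mult[OF V Xt] by simp
  finally have At: "A\<^sup>T = (1 / sqrt (real n)) \<cdot>\<^sub>m (X * V\<^sup>T)" .
  have XV: "X * V\<^sup>T \<in> carrier_mat n p" using X Vt by auto
  have "A * 1\<^sub>m n * A\<^sup>T = A * A\<^sup>T" using right_mult_one_mat[OF A] by simp
  also have "\<dots> = (1 / sqrt (real n)) \<cdot>\<^sub>m (A * (X * V\<^sup>T))"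
    unfolding At by (rule mult_smult_distrib[OF A XV])
  also have "A * (X * V\<^sup>T) = (1 / sqrt (real n)) \<cdot>\<^sub>m ((V * X\<^sup>T) * (X * V\<^sup>T))"
    unfolding A_def by (rule mult_smult_assoc_mat[OF VX XV])
  also have "(V * X\<^sup>T) * (X * V\<^sup>T) = V * (X\<^sup>T * X) * V\<^sup>T"
    using assoc_mult_mat[OF VX X Vt] assoc_mult_mat[OF V Xt X] by simp
  also have "(1 / sqrt (real n)) \<cdot>\<^sub>m ((1 / sqrt (real n)) \<cdot>\<^sub>m (V * (X\<^sup>T * X) * V\<^sup>T)) =
      (1 / real n) \<cdot>\<^sub>m (V * (X\<^sup>T * X) * V\<^sup>T)"
    by (rule eq_matI) auto
  also have "\<dots> = (1 / real n) \<cdot>\<^sub>m (V * (X\<^sup>T * X)) * V\<^sup>T"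
    by (rule mult_smult_assoc_mat[symmetric, of _ p p]) (use V G Vt in auto)
  also have "(1 / real n) \<cdot>\<^sub>m (V * (X\<^sup>T * X)) = V * gram X"
    unfolding gram_def dX by (rule mult_smult_distrib[OF V G, symmetric])
  finally show ?thesis .
qed

lemma noise_variance_nonneg:
  assumes X: "X \<in> carrier_mat n p" and V: "V \<in> carrier_mat p p" and i: "i < p"
  shows "0 \<le> (V * gram X * V\<^sup>T) $$ (i, i)"
proof -
  define A where "A = (1 / sqrt (real n)) \<cdot>\<^sub>m (V * X\<^sup>T)"
  have A: "A \<in> carrier_mat p n" unfolding A_def using X V by auto
  have "(V * gram X * V\<^sup>T) $$ (i, i) = (A * A\<^sup>T) $$ (i, i)"
    unfolding noise_covariance[OF X V, symmetric] A_def[symmetric] using right_mult_one_mat[OF A] by simp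
  also have "\<dots> = scalar_prod (Matrix.row A i) (Matrix.row A i)" using A i by auto
  also have "\<dots> \<ge> 0" unfolding scalar_prod_def by (intro sum_nonneg) auto
  finally show ?thesis .
qed

lemma variance_le_max_var:
  assumes X: "X \<in> carrier_mat n p" and V: "V \<in> carrier_mat p p" and i: "i < p"
  shows "(V * gram X * V\<^sup>T) $$ (i, i) \<le> max_var V X"
  unfolding max_var_eq[OF X V] using i by (intro Max_ge) auto

lemma max_var_nonneg:
  assumes X: "X \<in> carrier_mat n p" and V: "V \<in> carrier_mat p p" and p: "0 < p"
  shows "0 \<le> max_var V X"
  using noise_variance_nonneg[OF X V p] variance_le_max_var[OF X V p] by linarith

lemma mv_normal_noise_term:
  assumes \<nu>: "mv_normal n (0\<^sub>v n) (1\<^sub>m n) \<nu>" and X: "X \<in> carrier_mat n p" and V: "V \<in> carrier_mat p p"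
  shows "mv_normal p (0\<^sub>v p) (V * gram X * V\<^sup>T) (distr \<nu> (vec_borel p) (noise_term V X))"
proof -
  define A where "A = (1 / sqrt (real n)) \<cdot>\<^sub>m (V * X\<^sup>T)"
  have A: "A \<in> carrier_mat p n" unfolding A_def using X V by auto
  have dX: "dim_row X = n" using X by auto
  have sets: "sets \<nu> = sets (vec_borel n)" using \<nu> by (simp add: mv_normal_def)
  have sp: "space \<nu> = carrier_vec n" using sets_eq_imp_space_eq[OF sets] by simp
  have "distr \<nu> (vec_borel p) (noise_term V X) = distr \<nu> (vec_borel p) (\<lambda>e. A *\<^sub>v e)"
  proof (intro distr_cong refl)
    fix e assume "e \<in> space \<nu>"
    then have "dim_vec e = dim_col (V * X\<^sup>T)" using sp dX by simp
    then show "noise_term V X e = A *\<^sub>v e"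
      unfolding A_def by (subst smult_mat_mult_vec) (auto simp: noise_term_def dX)
  qed
  moreover have "A *\<^sub>v 0\<^sub>v n = 0\<^sub>v p"
    using A by (intro eq_vecI) (auto simp: scalar_prod_def)
  ultimately show ?thesis
    using mv_normal_linear_image[OF \<nu> A] noise_covariance[OF X V] unfolding A_def by simp
qed

section \<open>Conditioning on the design\<close>

context sparse_regression
begin

lemma p_pos: "0 < p"
  using K_bounds by simp

lemma X_carrier: "\<omega> \<in> space P \<Longrightarrow> X \<omega> \<in> carrier_mat n p"
  using measurable_space[OF X_measurable] by simp

lemma noise_carrier: "\<omega> \<in> space P \<Longrightarrow> \<epsilon> \<omega> \<in> carrier_vec n"
  using measurable_space[OF noise_measurable] by simp

lemma V_carrier: "x \<in> carrier_mat n p \<Longrightarrow> V x \<in> carrier_mat p p"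
  using measurable_space[OF V_measurable] by simp

lemma theta_carrier: "\<theta> \<in> carrier_vec p"
  using theta_sparse by (auto simp: sparse_vecs_def)

lemma VX_measurable: "(\<lambda>\<omega>. V (X \<omega>)) \<in> P \<rightarrow>\<^sub>M mat_borel p p"
  using measurable_compose[OF X_measurable V_measurable] .

text \<open>The variables \<open>X\<close> and \<open>\<epsilon>\<close> have different value types, so the product form of their joint law is
  checked on rectangles, which generate the product sigma-algebra.\<close>

lemma joint_law:
  "distr P (mat_borel n p) X \<Otimes>\<^sub>M distr P (vec_borel n) \<epsilon> =
     distr P (mat_borel n p \<Otimes>\<^sub>M vec_borel n) (\<lambda>\<omega>. (X \<omega>, \<epsilon> \<omega>))"
proof (rule pair_measure_eqI)
  show "sigma_finite_measure (distr P (mat_borel n p) X)"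
    using prob_space_distr[OF X_measurable] by (rule prob_space_imp_sigma_finite)
  show "sigma_finite_measure (distr P (vec_borel n) \<epsilon>)"
    using prob_space_distr[OF noise_measurable] by (rule prob_space_imp_sigma_finite)
  note [measurable] = X_measurable noise_measurable
  fix A C assume "A \<in> sets (distr P (mat_borel n p) X)" "C \<in> sets (distr P (vec_borel n) \<epsilon>)"
  then have A [measurable]: "A \<in> sets (mat_borel n p)" and C [measurable]: "C \<in> sets (vec_borel n)" by auto
  have "prob ((X -` A \<inter> space P) \<inter> (\<epsilon> -` C \<inter> space P)) =
      prob (X -` A \<inter> space P) * prob (\<epsilon> -` C \<inter> space P)"
    by (rule indep_setD[OF noise_indep]) (use A C in auto)
  moreover have "(X -` A \<inter> space P) \<inter> (\<epsilon> -` C \<inter> space P) = (\<lambda>\<omega>. (X \<omega>, \<epsilon> \<omega>)) -` (A \<times> C) \<inter> space P"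
    by auto
  ultimately show "emeasure (distr P (mat_borel n p) X) A * emeasure (distr P (vec_borel n) \<epsilon>) C =
      emeasure (distr P (mat_borel n p \<Otimes>\<^sub>M vec_borel n) (\<lambda>\<omega>. (X \<omega>, \<epsilon> \<omega>))) (A \<times> C)"
    by (simp add: emeasure_distr emeasure_eq_measure ennreal_mult)
qed (simp cong: sets_pair_measure_cong)

text \<open>Integrating over the noise first reduces both the conditional law and the tail bound to a fixed
  design, where the noise term is a linear image of a standard Gaussian vector.\<close>

lemma emeasure_disintegrate:
  assumes E: "E \<in> sets (mat_borel n p \<Otimes>\<^sub>M vec_borel n)"
  shows "emeasure P {\<omega> \<in> space P. (X \<omega>, \<epsilon> \<omega>) \<in> E} =
     (\<integral>\<^sup>+\<omega>. emeasure (distr P (vec_borel n) \<epsilon>) (Pair (X \<omega>) -` E) \<partial>P)"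
proof -
  let ?N = "distr P (vec_borel n) \<epsilon>"
  interpret N: prob_space ?N by (rule prob_space_distr[OF noise_measurable])
  have E': "E \<in> sets (mat_borel n p \<Otimes>\<^sub>M ?N)"
    using E by (simp cong: sets_pair_measure_cong)
  have "sets (distr P (mat_borel n p) X \<Otimes>\<^sub>M ?N) = sets (mat_borel n p \<Otimes>\<^sub>M vec_borel n)"
    by (rule sets_pair_measure_cong) simp_all
  then have E'': "E \<in> sets (distr P (mat_borel n p) X \<Otimes>\<^sub>M ?N)"
    by (rule ssubst[where P="\<lambda>S. E \<in> S"]) (rule E)
  have "emeasure P {\<omega> \<in> space P. (X \<omega>, \<epsilon> \<omega>) \<in> E} =
      emeasure (distr P (mat_borel n p \<Otimes>\<^sub>M vec_borel n) (\<lambda>\<omega>. (X \<omega>, \<epsilon> \<omega>))) E"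
    using E X_measurable noise_measurable
    by (subst emeasure_distr) (auto intro!: arg_cong[where f="emeasure P"])
  also have "distr P (mat_borel n p \<Otimes>\<^sub>M vec_borel n) (\<lambda>\<omega>. (X \<omega>, \<epsilon> \<omega>)) =
      distr P (mat_borel n p) X \<Otimes>\<^sub>M ?N"
    by (rule joint_law[symmetric])
  also have "emeasure \<dots> E = (\<integral>\<^sup>+x. emeasure ?N (Pair x -` E) \<partial>distr P (mat_borel n p) X)"
    by (rule N.emeasure_pair_measure_alt[OF E''])
  also have "\<dots> = (\<integral>\<^sup>+\<omega>. emeasure ?N (Pair (X \<omega>) -` E) \<partial>P)"
    by (rule nn_integral_distr[OF X_measurable]) (simp add: N.measurable_emeasure_Pair[OF E'])
  finally show ?thesis .
qed

definition noise_kernel :: "real mat \<Rightarrow> real vec measure" where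
  "noise_kernel x = distr (distr P (vec_borel n) \<epsilon>) (vec_borel p) (noise_term (V x) x)"

lemma noise_term_measurable_pair:
  "(\<lambda>(x, e). noise_term (V x) x e) \<in> mat_borel n p \<Otimes>\<^sub>M vec_borel n \<rightarrow>\<^sub>M vec_borel p"
proof -
  have "(\<lambda>z. noise_term (V (fst z)) (fst z) (snd z)) \<in> mat_borel n p \<Otimes>\<^sub>M vec_borel n \<rightarrow>\<^sub>M vec_borel p"
    by (intro measurable_noise_term[where n=n] measurable_compose[OF measurable_fst V_measurable])
      measurable
  then show ?thesis by (simp add: case_prod_beta')
qed

lemma noise_term_measurable:
  assumes "x \<in> carrier_mat n p"
  shows "noise_term (V x) x \<in> vec_borel n \<rightarrow>\<^sub>M vec_borel p"
  using measurable_noise_term[OF measurable_const_mat[OF assms] measurable_const_mat[OF V_carrier[OF assms]]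
      measurable_ident] by (simp add: id_def)

lemma mv_normal_noise_kernel:
  "x \<in> carrier_mat n p \<Longrightarrow> mv_normal p (0\<^sub>v p) (V x * gram x * (V x)\<^sup>T) (noise_kernel x)"
  unfolding noise_kernel_def by (rule mv_normal_noise_term[OF noise_law _ V_carrier])

lemma regular_cond_distr_noise:
  "regular_cond_distr P (mat_borel n p) X (vec_borel p)
     (\<lambda>\<omega>. noise_term (V (X \<omega>)) (X \<omega>) (\<epsilon> \<omega>)) noise_kernel"
  unfolding regular_cond_distr_def
proof (intro conjI ballI)
  let ?N = "distr P (vec_borel n) \<epsilon>"
  show "X \<in> P \<rightarrow>\<^sub>M mat_borel n p" by (rule X_measurable)
  show "(\<lambda>\<omega>. noise_term (V (X \<omega>)) (X \<omega>) (\<epsilon> \<omega>)) \<in> P \<rightarrow>\<^sub>M vec_borel p"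
    by (rule measurable_noise_term[OF X_measurable VX_measurable noise_measurable])
  have "prob_space ?N" by (rule prob_space_distr[OF noise_measurable])
  then show "noise_kernel \<in> mat_borel n p \<rightarrow>\<^sub>M prob_algebra (vec_borel p)"
    unfolding noise_kernel_def[abs_def]
    by (intro measurable_distr_prob_space2[where M="vec_borel n"] measurable_const noise_term_measurable_pair)
      (simp add: space_prob_algebra)
  fix A B assume A: "A \<in> sets (mat_borel n p)" and B: "B \<in> sets (vec_borel p)"
  define E where "E = {z \<in> space (mat_borel n p \<Otimes>\<^sub>M vec_borel n).
      fst z \<in> A \<and> (\<lambda>(x, e). noise_term (V x) x e) z \<in> B}"
  have E: "E \<in> sets (mat_borel n p \<Otimes>\<^sub>M vec_borel n)"
  proof -
    note [measurable] = A B noise_term_measurable_pair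
    show ?thesis unfolding E_def by measurable
  qed
  have "emeasure P {\<omega> \<in> space P. X \<omega> \<in> A \<and> noise_term (V (X \<omega>)) (X \<omega>) (\<epsilon> \<omega>) \<in> B} =
      emeasure P {\<omega> \<in> space P. (X \<omega>, \<epsilon> \<omega>) \<in> E}"
    using X_carrier noise_carrier
    by (intro arg_cong[where f="emeasure P"]) (auto simp: E_def space_pair_measure)
  also have "\<dots> = (\<integral>\<^sup>+\<omega>. emeasure ?N (Pair (X \<omega>) -` E) \<partial>P)"
    by (rule emeasure_disintegrate[OF E])
  also have "\<dots> = (\<integral>\<^sup>+\<omega>\<in>{\<omega> \<in> space P. X \<omega> \<in> A}. emeasure (noise_kernel (X \<omega>)) B \<partial>P)"
  proof (rule nn_integral_cong)
    fix \<omega> assume \<omega>: "\<omega> \<in> space P"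
    note Xc = X_carrier[OF \<omega>]
    have m: "noise_term (V (X \<omega>)) (X \<omega>) \<in> ?N \<rightarrow>\<^sub>M vec_borel p"
      using noise_term_measurable[OF Xc] by simp
    show "emeasure ?N (Pair (X \<omega>) -` E) =
        emeasure (noise_kernel (X \<omega>)) B * indicator {\<omega> \<in> space P. X \<omega> \<in> A} \<omega>"
    proof (cases "X \<omega> \<in> A")
      case True
      have "Pair (X \<omega>) -` E = noise_term (V (X \<omega>)) (X \<omega>) -` B \<inter> space ?N"
        using True Xc by (auto simp: E_def space_pair_measure)
      then show ?thesis using True \<omega> B by (simp add: noise_kernel_def emeasure_distr[OF m])
    next
      case False
      then have "Pair (X \<omega>) -` E = {}" by (auto simp: E_def)
      then show ?thesis using False by simp
    qed
  qed
  finally show "emeasure P {\<omega> \<in> space P. X \<omega> \<in> A \<and> noise_term (V (X \<omega>)) (X \<omega>) (\<epsilon> \<omega>) \<in> B} =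
      (\<integral>\<^sup>+\<omega>\<in>{\<omega> \<in> space P. X \<omega> \<in> A}. emeasure (noise_kernel (X \<omega>)) B \<partial>P)" .
qed

lemma noise_event_measurable:
  "{\<omega> \<in> space P. 2 * sqrt (max_var (V (X \<omega>)) (X \<omega>) * L) <
      vec_linf (noise_term (V (X \<omega>)) (X \<omega>) (\<epsilon> \<omega>))} \<in> sets P"
proof -
  have [measurable]: "(\<lambda>\<omega>. max_var (V (X \<omega>)) (X \<omega>)) \<in> borel_measurable P"
    by (rule measurable_max_var[OF X_measurable VX_measurable])
  have [measurable]: "(\<lambda>\<omega>. vec_linf (noise_term (V (X \<omega>)) (X \<omega>) (\<epsilon> \<omega>))) \<in> borel_measurable P"
    by (rule measurable_vec_linf[OF measurable_noise_term[OF X_measurable VX_measurable noise_measurable]])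
  show ?thesis by measurable
qed

lemma noise_exceeds_prob:
  assumes L: "0 \<le> L"
  shows "prob {\<omega> \<in> space P. 2 * sqrt (max_var (V (X \<omega>)) (X \<omega>) * L) <
      vec_linf (noise_term (V (X \<omega>)) (X \<omega>) (\<epsilon> \<omega>))} \<le> real p * (2 * exp (- (3 / 2) * L))"
proof -
  let ?c = "real p * (2 * exp (- (3 / 2) * L))"
  let ?Q = "\<lambda>x e. 2 * sqrt (max_var (V x) x * L) < vec_linf (noise_term (V x) x e)"
  let ?N = "distr P (vec_borel n) \<epsilon>"
  define E where "E = {z \<in> space (mat_borel n p \<Otimes>\<^sub>M vec_borel n). ?Q (fst z) (snd z)}"
  have E: "E \<in> sets (mat_borel n p \<Otimes>\<^sub>M vec_borel n)"
  proof -
    have V2: "(\<lambda>z. V (fst z)) \<in> mat_borel n p \<Otimes>\<^sub>M vec_borel n \<rightarrow>\<^sub>M mat_borel p p"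
      by (rule measurable_compose[OF measurable_fst V_measurable])
    have [measurable]: "(\<lambda>z. max_var (V (fst z)) (fst z)) \<in> borel_measurable (mat_borel n p \<Otimes>\<^sub>M vec_borel n)"
      by (rule measurable_max_var[OF measurable_fst V2])
    have [measurable]: "(\<lambda>z. vec_linf (noise_term (V (fst z)) (fst z) (snd z)))
        \<in> borel_measurable (mat_borel n p \<Otimes>\<^sub>M vec_borel n)"
      by (rule measurable_vec_linf[OF measurable_noise_term[OF measurable_fst V2 measurable_snd]])
    show ?thesis unfolding E_def by measurable
  qed
  have "emeasure P {\<omega> \<in> space P. ?Q (X \<omega>) (\<epsilon> \<omega>)} = emeasure P {\<omega> \<in> space P. (X \<omega>, \<epsilon> \<omega>) \<in> E}"
    using X_carrier noise_carrier
    by (intro arg_cong[where f="emeasure P"]) (auto simp: E_def space_pair_measure)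
  also have "\<dots> = (\<integral>\<^sup>+\<omega>. emeasure ?N (Pair (X \<omega>) -` E) \<partial>P)"
    by (rule emeasure_disintegrate[OF E])
  also have "\<dots> \<le> (\<integral>\<^sup>+\<omega>. ennreal ?c \<partial>P)"
  proof (rule nn_integral_mono)
    fix \<omega> assume \<omega>: "\<omega> \<in> space P"
    let ?x = "X \<omega>"
    note Xc = X_carrier[OF \<omega>]
    have m: "noise_term (V ?x) ?x \<in> ?N \<rightarrow>\<^sub>M vec_borel p"
      using noise_term_measurable[OF Xc] by simp
    define T where "T = {v \<in> space (vec_borel p). 2 * sqrt (max_var (V ?x) ?x * L) < vec_linf v}"
    have T: "T \<in> sets (vec_borel p)"
    proof -
      have [measurable]: "vec_linf \<in> borel_measurable (vec_borel p)"
        using measurable_vec_linf[OF measurable_ident[of "vec_borel p"]] by (simp add: id_def)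
      show ?thesis unfolding T_def by measurable
    qed
    have "Pair ?x -` E = noise_term (V ?x) ?x -` T \<inter> space ?N"
      using Xc measurable_space[OF m] by (auto simp: E_def T_def space_pair_measure)
    then have "emeasure ?N (Pair ?x -` E) = emeasure (noise_kernel ?x) T"
      by (simp add: noise_kernel_def emeasure_distr[OF m T])
    also have "T = {v \<in> space (noise_kernel ?x). 2 * sqrt (max_var (V ?x) ?x * L) < vec_linf v}"
      by (simp add: T_def noise_kernel_def)
    also have "emeasure (noise_kernel ?x) \<dots> \<le> ennreal ?c"
      using noise_variance_nonneg[OF Xc V_carrier[OF Xc]] variance_le_max_var[OF Xc V_carrier[OF Xc]]
        max_var_nonneg[OF Xc V_carrier[OF Xc] p_pos] L
      by (intro mv_normal_linf_tail[OF mv_normal_noise_kernel[OF Xc]]) auto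
    finally show "emeasure ?N (Pair ?x -` E) \<le> ennreal ?c" .
  qed
  also have "\<dots> = ennreal ?c" by (simp add: emeasure_space_1)
  finally show ?thesis
    by (simp add: emeasure_eq_measure)
qed

end

section \<open>The bias for one sample size\<close>

context sparse_regression
begin

lemma theta_sparse_K: "\<theta> \<in> sparse_vecs p K"
  using theta_sparse by (auto simp: sparse_vecs_def)

lemma response_measurable: "(\<lambda>\<omega>. response (X \<omega>) \<theta> (\<epsilon> \<omega>)) \<in> P \<rightarrow>\<^sub>M vec_borel n"
  unfolding response_def
  by (rule measurable_add_vec[OF measurable_mult_mat_vec[OF X_measurable measurable_const_vec[OF theta_carrier]]
        noise_measurable])

lemma bias_measurable:
  "(\<lambda>\<omega>. vec_linf (bias_term \<rho> \<delta> B (V (X \<omega>)) (X \<omega>) (response (X \<omega>) \<theta> (\<epsilon> \<omega>)) \<theta>)) \<in> borel_measurable P"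
  by (rule measurable_vec_linf[OF measurable_bias_term[OF X_measurable VX_measurable
          response_measurable theta_carrier]])

lemma max_var_measurable: "(\<lambda>\<omega>. max_var (V (X \<omega>)) (X \<omega>)) \<in> borel_measurable P"
  by (rule measurable_max_var[OF X_measurable VX_measurable])

definition noise_exceeds :: "'a set" where
  "noise_exceeds = {\<omega> \<in> space P. 2 * sqrt (max_var (V (X \<omega>)) (X \<omega>) * ln (real p / \<delta>)) <
      vec_linf (noise_term (V (X \<omega>)) (X \<omega>) (\<epsilon> \<omega>))}"

lemma noise_exceeds_sets: "noise_exceeds \<in> sets P"
  unfolding noise_exceeds_def by (rule noise_event_measurable)

text \<open>With the level \<open>L = ln (p / \<delta>) \<ge> ln p\<close>, the union bound gives at most
  \<open>2 p p\<^sup>-\<^sup>3\<^sup>/\<^sup>2 \<le> 2 n\<^sup>-\<^sup>1\<^sup>/\<^sup>2\<close>, which vanishes although \<open>\<delta>\<close> is fixed.\<close>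

lemma noise_exceeds_le:
  assumes "n < p"
  shows "prob noise_exceeds \<le> 2 * real n powr (- (1 / 2))"
proof -
  have p1: "1 \<le> real p" and p0: "0 < real p" and n0: "0 < real n" using p_pos n_pos by auto
  have L: "ln (real p) \<le> ln (real p / \<delta>)"
    using p0 delta_bounds by (simp add: ln_div)
  moreover have "0 \<le> ln (real p)" using p1 by simp
  ultimately have "prob noise_exceeds \<le> real p * (2 * exp (- (3 / 2) * ln (real p / \<delta>)))"
    unfolding noise_exceeds_def by (intro noise_exceeds_prob) linarith
  also have "\<dots> \<le> real p * (2 * exp (- (3 / 2) * ln (real p)))"
    using L by (intro mult_left_mono) auto
  also have "\<dots> = 2 * (exp (ln (real p)) * exp (- (3 / 2) * ln (real p)))"
    using p0 by simp
  also have "\<dots> = 2 * real p powr (- (1 / 2))"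
    unfolding exp_add[symmetric] powr_def using p0 by (simp add: field_simps)
  also have "\<dots> \<le> 2 * real n powr (- (1 / 2))"
    using assms n0 by (intro mult_left_mono powr_mono2') auto
  finally show ?thesis .
qed

text \<open>The form used for all three asymptotic conclusions: the constant depends on \<open>B\<close> and \<open>\<delta>\<close> only,
  since \<open>p \<ge> 2\<close> gives \<open>ln (p / \<delta>) \<le> (1 - ln \<delta> / ln 2) ln p\<close>.\<close>

lemma bias_le:
  assumes \<omega>: "\<omega> \<in> space P" "\<omega> \<notin> noise_exceeds"
    and cond: "approx_inverse_cond K r (V (X \<omega>)) (X \<omega>)"
    and np: "n < p" and small: "r K \<le> 1 / 4"
  shows "vec_linf (bias_term (r K) \<delta> B (V (X \<omega>)) (X \<omega>) (response (X \<omega>) \<theta> (\<epsilon> \<omega>)) \<theta>)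
     \<le> (2 * B + 8 * sqrt (1 - ln \<delta> / ln 2)) * r K * (1 + sqrt (max_var (V (X \<omega>)) (X \<omega>) * ln (real p)))"
proof -
  define \<rho> where "\<rho> = r K"
  define M where "M = max_var (V (X \<omega>)) (X \<omega>)"
  define c where "c = sqrt (1 - ln \<delta> / ln 2)"
  define s where "s = sqrt (M * ln (real p))"
  note Xc = X_carrier[OF \<omega>(1)]
  note Vc = V_carrier[OF Xc]
  have \<rho>: "0 < \<rho>" "2 * \<rho> < 1" "\<rho> \<le> 1 / 4" using r_pos[of K] K_bounds r_K_small small by (auto simp: \<rho>_def)
  have M0: "0 \<le> M" using max_var_nonneg[OF Xc Vc p_pos] by (simp add: M_def)
  have p2: "2 \<le> real p" using np n_pos by simp
  have lp: "ln 2 \<le> ln (real p)" using p2 by simp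
  have ld: "ln \<delta> < 0" using delta_bounds by simp
  then have ld2: "ln \<delta> \<le> ln 2" using ln_gt_zero[of "2::real"] by linarith
  have s0: "0 \<le> s" "0 \<le> c" using M0 p2 ld ld2
    by (auto simp: s_def c_def)
  have "ln (real p / \<delta>) = ln (real p) + (- ln \<delta> / ln 2) * ln 2"
    using p2 delta_bounds by (simp add: ln_div)
  also have "\<dots> \<le> ln (real p) + (- ln \<delta> / ln 2) * ln (real p)"
    using lp ld by (intro add_left_mono mult_left_mono) (auto simp: divide_nonpos_pos)
  also have "\<dots> = (1 - ln \<delta> / ln 2) * ln (real p)" by (simp add: algebra_simps)
  finally have "M * ln (real p / \<delta>) \<le> M * ((1 - ln \<delta> / ln 2) * ln (real p))"
    using M0 by (rule mult_left_mono)
  then have "sqrt (M * ln (real p / \<delta>)) \<le> sqrt ((1 - ln \<delta> / ln 2) * (M * ln (real p)))"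
    by (intro real_sqrt_le_mono) (simp add: mult_ac)
  then have sq: "sqrt (M * ln (real p / \<delta>)) \<le> c * s"
    by (simp add: c_def s_def real_sqrt_mult)
  have noise: "vec_linf (noise_term (V (X \<omega>)) (X \<omega>) (\<epsilon> \<omega>)) \<le> 2 * sqrt (M * ln (real p / \<delta>))"
    using \<omega> by (auto simp: noise_exceeds_def M_def not_less)
  have "vec_linf (bias_term \<rho> \<delta> B (V (X \<omega>)) (X \<omega>) (response (X \<omega>) \<theta> (\<epsilon> \<omega>)) \<theta>) \<le>
      2 * \<rho> * B / sqrt (real n) + 4 * \<rho> / (1 - 2 * \<rho>) * sqrt (M * ln (real p / \<delta>))"
    unfolding \<rho>_def M_def
    by (rule bias_term_bound[OF Xc Vc noise_carrier[OF \<omega>(1)] n_pos K_bounds(1) \<rho>(1)[unfolded \<rho>_def] r_K_small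
          cond theta_sparse_K theta_bounded B_pos noise[unfolded M_def]])
  also have "\<dots> \<le> 2 * \<rho> * B + 8 * \<rho> * (c * s)"
  proof (intro add_mono mult_mono sq)
    have "1 \<le> sqrt (real n)" using n_pos by simp
    then show "2 * \<rho> * B / sqrt (real n) \<le> 2 * \<rho> * B"
      using \<rho> B_pos divide_left_mono[of 1 "sqrt (real n)" "2 * \<rho> * B"] by simp
    show "4 * \<rho> / (1 - 2 * \<rho>) \<le> 8 * \<rho>"
      using \<rho> by (simp add: divide_le_eq)
    have "0 \<le> ln (real p / \<delta>)" using p2 delta_bounds by (intro ln_ge_zero) (simp add: le_divide_eq)
    then show "0 \<le> sqrt (M * ln (real p / \<delta>))" using M0 by simp
  qed (use \<rho> in auto)
  also have "\<dots> \<le> (2 * B + 8 * c) * \<rho> * (1 + s)"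
    using \<rho> s0 B_pos by (simp add: algebra_simps)
  finally show ?thesis by (simp add: \<rho>_def M_def c_def s_def)
qed

end

section \<open>Stochastic order symbols\<close>

lemma small_o_P_one_dominated:
  assumes g: "small_o_P_one P g"
    and f: "\<forall>\<^sub>F n in sequentially. f n \<in> borel_measurable (P n)"
    and P: "\<forall>\<^sub>F n in sequentially. prob_space (P n)"
    and H: "\<forall>\<^sub>F n in sequentially. H n \<in> sets (P n)" "(\<lambda>n. measure (P n) (H n)) \<longlonglongrightarrow> 0"
    and le: "\<forall>\<^sub>F n in sequentially. \<forall>\<omega>\<in>space (P n) - H n. \<bar>f n \<omega>\<bar> \<le> g n \<omega>"
  shows "small_o_P_one P f"
  unfolding small_o_P_one_def
proof (intro conjI f allI impI)
  fix e :: real assume e: "e > 0"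
  let ?S = "\<lambda>f n. {\<omega> \<in> space (P n). \<bar>f n \<omega>\<bar> > e}"
  have g0: "(\<lambda>n. measure (P n) (?S g n)) \<longlonglongrightarrow> 0" using g e by (simp add: small_o_P_one_def)
  have gm: "\<forall>\<^sub>F n in sequentially. g n \<in> borel_measurable (P n)" using g by (simp add: small_o_P_one_def)
  show "(\<lambda>n. measure (P n) (?S f n)) \<longlonglongrightarrow> 0"
  proof (rule tendsto_sandwich[OF _ _ tendsto_const])
    show "(\<lambda>n. measure (P n) (H n) + measure (P n) (?S g n)) \<longlonglongrightarrow> 0"
      using tendsto_add[OF H(2) g0] by simp
    show "\<forall>\<^sub>F n in sequentially. measure (P n) (?S f n) \<le> measure (P n) (H n) + measure (P n) (?S g n)"
      using gm P H(1) le
    proof eventually_elim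
      case (elim n)
      interpret prob_space "P n" by fact
      note [measurable] = elim(1,3)
      have S: "?S g n \<in> sets (P n)" by measurable
      have "?S f n \<subseteq> H n \<union> ?S g n"
      proof
        fix \<omega> assume \<omega>: "\<omega> \<in> ?S f n"
        then have "\<bar>f n \<omega>\<bar> \<le> g n \<omega>" if "\<omega> \<notin> H n" using elim(4) that by auto
        then show "\<omega> \<in> H n \<union> ?S g n" using \<omega> by (cases "\<omega> \<in> H n") auto
      qed
      then have "measure (P n) (?S f n) \<le> measure (P n) (H n \<union> ?S g n)"
        using S elim(3) by (intro finite_measure_mono) auto
      also have "\<dots> \<le> measure (P n) (H n) + measure (P n) (?S g n)"
        using S elim(3) by (intro measure_Un_le) auto
      finally show ?case .
    qed
  qed simp
qed

lemma small_o_P_one_zero: "small_o_P_one P (\<lambda>_ _. 0)"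
  by (simp add: small_o_P_one_def)

lemma small_o_P_one_affine:
  assumes h: "small_o_P_one P h" and a: "a \<longlonglongrightarrow> 0" and C: "0 \<le> C"
    and P: "\<forall>\<^sub>F n in sequentially. prob_space (P n)"
  shows "small_o_P_one P (\<lambda>n \<omega>. a n + C * h n \<omega>)"
  unfolding small_o_P_one_def
proof (intro conjI allI impI)
  have hm: "\<forall>\<^sub>F n in sequentially. h n \<in> borel_measurable (P n)" using h by (simp add: small_o_P_one_def)
  then show "\<forall>\<^sub>F n in sequentially. (\<lambda>\<omega>. a n + C * h n \<omega>) \<in> borel_measurable (P n)"
    by eventually_elim measurable
  fix e :: real assume e: "e > 0"
  define d where "d = e / (2 * (C + 1))"
  have d: "0 < d" using e C by (simp add: d_def)
  have h0: "(\<lambda>n. measure (P n) {\<omega> \<in> space (P n). \<bar>h n \<omega>\<bar> > d}) \<longlonglongrightarrow> 0"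
    using h d by (simp add: small_o_P_one_def)
  have ea: "\<forall>\<^sub>F n in sequentially. \<bar>a n\<bar> < e / 2"
    using a e by (auto simp: tendsto_iff dist_real_def elim: allE[of _ "e / 2"])
  show "(\<lambda>n. measure (P n) {\<omega> \<in> space (P n). \<bar>a n + C * h n \<omega>\<bar> > e}) \<longlonglongrightarrow> 0"
  proof (rule tendsto_sandwich[OF _ _ tendsto_const h0])
    show "\<forall>\<^sub>F n in sequentially. measure (P n) {\<omega> \<in> space (P n). \<bar>a n + C * h n \<omega>\<bar> > e} \<le>
        measure (P n) {\<omega> \<in> space (P n). \<bar>h n \<omega>\<bar> > d}"
      using hm ea P
    proof eventually_elim
      case (elim n)
      interpret prob_space "P n" by fact
      note [measurable] = elim(1)
      have "\<bar>a n + C * h n \<omega>\<bar> \<le> e" if "\<bar>h n \<omega>\<bar> \<le> d" for \<omega>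
      proof -
        have "C * \<bar>h n \<omega>\<bar> \<le> C * d" using that C by (rule mult_left_mono)
        also have "\<dots> \<le> e / 2" using C e by (simp add: d_def field_simps)
        finally have "\<bar>C * h n \<omega>\<bar> \<le> e / 2" using C by (simp add: abs_mult)
        then show ?thesis using elim(2) by linarith
      qed
      then show ?case
        by (intro finite_measure_mono) (auto simp: not_le[symmetric])
    qed
  qed simp
qed

lemma small_o_P_one_mult_sqrt:
  assumes M: "big_O_P_one P M" and b: "b \<longlonglongrightarrow> 0"
    and P: "\<forall>\<^sub>F n in sequentially. prob_space (P n)"
  shows "small_o_P_one P (\<lambda>n \<omega>. b n * sqrt (M n \<omega>))"
  unfolding small_o_P_one_def
proof (intro conjI allI impI)
  have Mm: "\<forall>\<^sub>F n in sequentially. M n \<in> borel_measurable (P n)" using M by (simp add: big_O_P_one_def)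
  then show "\<forall>\<^sub>F n in sequentially. (\<lambda>\<omega>. b n * sqrt (M n \<omega>)) \<in> borel_measurable (P n)"
    by eventually_elim measurable
  fix e :: real assume e: "e > 0"
  let ?m = "\<lambda>n. measure (P n) {\<omega> \<in> space (P n). \<bar>b n * sqrt (M n \<omega>)\<bar> > e}"
  show "?m \<longlonglongrightarrow> 0"
  proof (rule tendstoI)
    fix \<eta> :: real assume \<eta>: "0 < \<eta>"
    then obtain C where C: "\<forall>\<^sub>F n in sequentially. measure (P n) {\<omega> \<in> space (P n). \<bar>M n \<omega>\<bar> > C} \<le> \<eta> / 2"
      using M unfolding big_O_P_one_def by (meson half_gt_zero)
    have "(\<lambda>n. b n * sqrt \<bar>C\<bar>) \<longlonglongrightarrow> 0" using tendsto_mult_left_zero[OF b] .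
    then have eb: "\<forall>\<^sub>F n in sequentially. \<bar>b n * sqrt \<bar>C\<bar>\<bar> < e"
      using e by (auto simp: tendsto_iff dist_real_def)
    show "\<forall>\<^sub>F n in sequentially. dist (?m n) 0 < \<eta>"
      using Mm P C eb
    proof eventually_elim
      case (elim n)
      interpret prob_space "P n" by fact
      note [measurable] = elim(1)
      have "\<bar>b n * sqrt (M n \<omega>)\<bar> \<le> e" if "\<bar>M n \<omega>\<bar> \<le> C" for \<omega>
      proof -
        have "\<bar>sqrt (M n \<omega>)\<bar> = sqrt \<bar>M n \<omega>\<bar>" by (auto simp: abs_if real_sqrt_minus)
        also have "\<dots> \<le> sqrt \<bar>C\<bar>" using that by (intro real_sqrt_le_mono) linarith
        finally have "\<bar>sqrt (M n \<omega>)\<bar> \<le> sqrt \<bar>C\<bar>" .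
        then have "\<bar>b n\<bar> * \<bar>sqrt (M n \<omega>)\<bar> \<le> \<bar>b n\<bar> * sqrt \<bar>C\<bar>" by (rule mult_left_mono) simp
        then show ?thesis using elim(4) by (simp add: abs_mult)
      qed
      then have "?m n \<le> measure (P n) {\<omega> \<in> space (P n). \<bar>M n \<omega>\<bar> > C}"
        by (intro finite_measure_mono) (auto simp: not_le[symmetric])
      then show ?case using elim(3) \<eta> by (simp add: dist_real_def)
    qed
  qed
qed

text \<open>The two rates multiply to \<open>\<rho> \<surd>(ln p) = O(K ln p / \<surd>n) = o(1)\<close>. As \<open>p \<ge> 3\<close> eventually, \<open>ln p \<ge> 1\<close>,
  and \<open>\<rho>\<close> itself tends to zero.\<close>

lemma rate_tendsto_zero:
  fixes \<rho> :: "nat \<Rightarrow> real" and K p :: "nat \<Rightarrow> nat"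
  assumes O: "\<rho> \<in> O(\<lambda>n. real (K n) * sqrt (ln (real (p n)) / real n))"
    and o: "(\<lambda>n. real (K n)) \<in> o(\<lambda>n. sqrt (real n) / ln (real (p n)))"
    and np: "\<forall>\<^sub>F n in sequentially. n < p n"
  shows "(\<lambda>n. \<rho> n * sqrt (ln (real (p n)))) \<longlonglongrightarrow> 0" "\<rho> \<longlonglongrightarrow> 0"
proof -
  obtain c where c: "0 < c" "\<forall>\<^sub>F n in sequentially. norm (\<rho> n) \<le> c * norm (real (K n) * sqrt (ln (real (p n)) / real n))"
    using landau_o.bigE[OF O] by blast
  show *: "(\<lambda>n. \<rho> n * sqrt (ln (real (p n)))) \<longlonglongrightarrow> 0"
  proof (rule tendstoI)
    fix e :: real assume e: "0 < e"
    define d where "d = e / (2 * c)"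
    have d: "0 < d" using e c by (simp add: d_def)
    have K: "\<forall>\<^sub>F n in sequentially. norm (real (K n)) \<le> d * norm (sqrt (real n) / ln (real (p n)))"
      using landau_o.smallD[OF o d] .
    show "\<forall>\<^sub>F n in sequentially. dist (\<rho> n * sqrt (ln (real (p n)))) 0 < e"
      using c(2) K np eventually_gt_at_top[of 1]
    proof eventually_elim
      case (elim n)
      define l where "l = sqrt (ln (real (p n)))"
      have l: "0 < l" "ln (real (p n)) = l\<^sup>2" using elim by (auto simp: l_def)
      define s where "s = sqrt (real n)"
      have s: "0 < s" using elim by (simp add: s_def)
      have 1: "\<bar>\<rho> n\<bar> \<le> c * (real (K n) * (l / s))"
        using elim(1) l s by (simp add: real_sqrt_divide l_def[symmetric] s_def[symmetric])
      have 2: "real (K n) \<le> d * (s / l\<^sup>2)"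
        using elim(2) s l by (simp add: s_def[symmetric])
      have "\<bar>\<rho> n\<bar> * l \<le> c * (real (K n) * (l / s)) * l"
        using 1 l by (intro mult_right_mono) auto
      also have "\<dots> \<le> c * (d * (s / l\<^sup>2) * (l / s)) * l"
        using 2 c l s by (intro mult_right_mono mult_left_mono) auto
      also have "\<dots> = c * d" using l s by (simp add: power2_eq_square)
      also have "\<dots> < e" using c e by (simp add: d_def)
      finally show ?case using l by (simp add: dist_real_def abs_mult l_def[symmetric])
    qed
  qed
  show "\<rho> \<longlonglongrightarrow> 0"
  proof (rule Lim_null_comparison[OF _ tendsto_rabs_zero[OF *]])
    show "\<forall>\<^sub>F n in sequentially. norm (\<rho> n) \<le> \<bar>\<rho> n * sqrt (ln (real (p n)))\<bar>"
      using np eventually_gt_at_top[of 1]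
    proof eventually_elim
      case (elim n)
      then have "exp 1 \<le> real (p n)" using exp_le by linarith
      then have "1 \<le> ln (real (p n))" using elim by (simp add: ln_ge_iff)
      then have "1 \<le> \<bar>sqrt (ln (real (p n)))\<bar>" by simp
      then have "\<bar>\<rho> n\<bar> * 1 \<le> \<bar>\<rho> n\<bar> * \<bar>sqrt (ln (real (p n)))\<bar>" by (intro mult_left_mono) auto
      then show ?case by (simp add: abs_mult)
    qed
  qed
qed

section \<open>The asymptotic statement\<close>

text \<open>The exceptional set is the union of the complement of the event on which the condition on \<open>V\<close>
  holds and the event that the noise exceeds its level. Off that set the bias is at most
  \<open>C r\<^sub>K (1 + S)\<close> with a fixed \<open>C\<close>; the first claim bounds the two summands separately, the
  second divides by \<open>1 + S\<close>.\<close>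

lemma bias_small_o:
  fixes P :: "nat \<Rightarrow> 'a measure"
  assumes model: "\<forall>\<^sub>F n in sequentially.
      sparse_regression (P n) n (p n) (K n) (k n) (r n) \<delta> B (\<theta> n) (X n) (\<epsilon> n) (V n) \<and> n < p n"
    and cond: "holds_with_prob_tending_to_one P
        (\<lambda>n \<omega>. approx_inverse_cond (K n) (r n) (V n (X n \<omega>)) (X n \<omega>))"
    and r0: "(\<lambda>n. r n (K n)) \<longlonglongrightarrow> 0"
  defines "D \<equiv> \<lambda>n \<omega>. vec_linf (bias_term (r n (K n)) \<delta> B (V n (X n \<omega>)) (X n \<omega>)
      (response (X n \<omega>) (\<theta> n) (\<epsilon> n \<omega>)) (\<theta> n))"
    and "S \<equiv> \<lambda>n \<omega>. sqrt (max_var (V n (X n \<omega>)) (X n \<omega>) * ln (real (p n)))"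
  shows "small_o_P_one P (\<lambda>n \<omega>. r n (K n) * S n \<omega>) \<Longrightarrow> small_o_P_one P D"
    and "small_o_P_one P (\<lambda>n \<omega>. D n \<omega> / (1 + S n \<omega>))"
proof -
  define C where "C = 2 * B + 8 * sqrt (1 - ln \<delta> / ln 2)"
  obtain G where G: "\<And>n. G n \<in> sets (P n)"
      "\<And>n \<omega>. \<omega> \<in> G n \<Longrightarrow> approx_inverse_cond (K n) (r n) (V n (X n \<omega>)) (X n \<omega>)"
    and G1: "(\<lambda>n. measure (P n) (G n)) \<longlonglongrightarrow> 1"
    using cond unfolding holds_with_prob_tending_to_one_def by blast
  define N where "N n = sparse_regression.noise_exceeds (P n) (p n) \<delta> (X n) (\<epsilon> n) (V n)" for n
  define H where "H n = (space (P n) - G n) \<union> N n" for n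
  have ps: "\<forall>\<^sub>F n in sequentially. prob_space (P n)"
    using model by eventually_elim (auto simp: sparse_regression_def)
  have Nset: "\<forall>\<^sub>F n in sequentially. N n \<in> sets (P n)"
    using model unfolding N_def by eventually_elim (auto intro: sparse_regression.noise_exceeds_sets)
  then have H: "\<forall>\<^sub>F n in sequentially. H n \<in> sets (P n)"
    by eventually_elim (use G(1) in \<open>auto simp: H_def\<close>)
  have H0: "(\<lambda>n. measure (P n) (H n)) \<longlonglongrightarrow> 0"
  proof (rule tendsto_sandwich[OF _ _ tendsto_const])
    have "filterlim real at_top sequentially" by (rule filterlim_real_sequentially)
    then have "(\<lambda>n. real n powr (- (1 / 2))) \<longlonglongrightarrow> 0" by (intro tendsto_neg_powr) auto
    then have "(\<lambda>n. (1 - measure (P n) (G n)) + 2 * real n powr (- (1 / 2))) \<longlonglongrightarrow> (1 - 1) + 2 * 0"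
      using G1 by (intro tendsto_intros)
    then show "(\<lambda>n. (1 - measure (P n) (G n)) + 2 * real n powr (- (1 / 2))) \<longlonglongrightarrow> 0" by simp
    show "\<forall>\<^sub>F n in sequentially. measure (P n) (H n) \<le> (1 - measure (P n) (G n)) + 2 * real n powr (- (1 / 2))"
      using model Nset
    proof eventually_elim
      case (elim n)
      then interpret sparse_regression "P n" n "p n" "K n" "k n" "r n" \<delta> B "\<theta> n" "X n" "\<epsilon> n" "V n" by simp
      have "measure (P n) (H n) \<le> measure (P n) (space (P n) - G n) + measure (P n) (N n)"
        unfolding H_def using G(1)[of n] elim by (intro measure_Un_le) auto
      also have "measure (P n) (space (P n) - G n) = 1 - measure (P n) (G n)"
        by (rule prob_compl[OF G(1)])
      also have "measure (P n) (N n) \<le> 2 * real n powr (- (1 / 2))"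
        unfolding N_def using elim by (intro noise_exceeds_le) simp
      finally show ?case by simp
    qed
  qed simp
  have Dm: "\<forall>\<^sub>F n in sequentially. D n \<in> borel_measurable (P n)"
    using model unfolding D_def by eventually_elim (auto intro: sparse_regression.bias_measurable)
  have Sm: "\<forall>\<^sub>F n in sequentially. S n \<in> borel_measurable (P n)"
    using model
  proof eventually_elim
    case (elim n)
    then interpret sparse_regression "P n" n "p n" "K n" "k n" "r n" \<delta> B "\<theta> n" "X n" "\<epsilon> n" "V n" by simp
    note [measurable] = max_var_measurable
    show ?case unfolding S_def by measurable
  qed
  have C: "0 \<le> C"
  proof -
    obtain n where "sparse_regression (P n) n (p n) (K n) (k n) (r n) \<delta> B (\<theta> n) (X n) (\<epsilon> n) (V n)"
      using model by (auto simp: eventually_sequentially)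
    then interpret sparse_regression "P n" n "p n" "K n" "k n" "r n" \<delta> B "\<theta> n" "X n" "\<epsilon> n" "V n" .
    have "ln \<delta> / ln 2 \<le> 0" using delta_bounds by (intro divide_nonpos_pos) auto
    then have "0 \<le> sqrt (1 - ln \<delta> / ln 2)" by (subst real_sqrt_ge_0_iff) linarith
    then show ?thesis using B_pos unfolding C_def by linarith
  qed
  have "\<forall>\<^sub>F n in sequentially. r n (K n) < 1 / 4"
    using order_tendstoD(2)[OF r0, of "1 / 4"] by simp
  then have le: "\<forall>\<^sub>F n in sequentially. \<forall>\<omega>\<in>space (P n) - H n.
      0 \<le> S n \<omega> \<and> D n \<omega> \<le> C * r n (K n) * (1 + S n \<omega>)"
    using model
  proof eventually_elim
    case (elim n)
    then interpret sparse_regression "P n" n "p n" "K n" "k n" "r n" \<delta> B "\<theta> n" "X n" "\<epsilon> n" "V n" by simp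
    show ?case
    proof (intro ballI conjI)
      fix \<omega> assume \<omega>: "\<omega> \<in> space (P n) - H n"
      note Xc = X_carrier[of \<omega>]
      show "0 \<le> S n \<omega>"
        unfolding S_def using \<omega> p_pos max_var_nonneg[OF Xc V_carrier[OF Xc] p_pos] by simp
      show "D n \<omega> \<le> C * r n (K n) * (1 + S n \<omega>)"
        unfolding D_def C_def S_def using \<omega> elim G(2)[of \<omega> n]
        by (intro bias_le) (auto simp: H_def N_def)
    qed
  qed
  have aC: "(\<lambda>n. C * r n (K n)) \<longlonglongrightarrow> 0" using tendsto_mult_right_zero[OF r0] .
  have D0: "0 \<le> D n \<omega>" for n \<omega> by (simp add: D_def vec_linf_nonneg)
  show "small_o_P_one P D" if rS: "small_o_P_one P (\<lambda>n \<omega>. r n (K n) * S n \<omega>)"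
  proof (rule small_o_P_one_dominated[OF small_o_P_one_affine[OF rS aC C ps] Dm ps H H0])
    show "\<forall>\<^sub>F n in sequentially. \<forall>\<omega>\<in>space (P n) - H n.
        \<bar>D n \<omega>\<bar> \<le> C * r n (K n) + C * (r n (K n) * S n \<omega>)"
      using le by eventually_elim (use D0 in \<open>auto simp: algebra_simps\<close>)
  qed
  show "small_o_P_one P (\<lambda>n \<omega>. D n \<omega> / (1 + S n \<omega>))"
  proof (rule small_o_P_one_dominated[OF small_o_P_one_affine[OF small_o_P_one_zero aC C ps] _ ps H H0])
    show "\<forall>\<^sub>F n in sequentially. (\<lambda>\<omega>. D n \<omega> / (1 + S n \<omega>)) \<in> borel_measurable (P n)"
      using Dm Sm
      by eventually_elim (intro borel_measurable_divide borel_measurable_add borel_measurable_const)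
    show "\<forall>\<^sub>F n in sequentially. \<forall>\<omega>\<in>space (P n) - H n.
        \<bar>D n \<omega> / (1 + S n \<omega>)\<bar> \<le> C * r n (K n) + C * 0"
      using le
    proof eventually_elim
      case (elim n)
      show ?case
      proof
        fix \<omega> assume "\<omega> \<in> space (P n) - H n"
        with elim have S: "0 < 1 + S n \<omega>" and "D n \<omega> \<le> C * r n (K n) * (1 + S n \<omega>)" by force+
        then have "D n \<omega> / (1 + S n \<omega>) \<le> C * r n (K n)" by (simp only: pos_divide_le_eq)
        moreover have "0 \<le> D n \<omega> / (1 + S n \<omega>)" using S D0[of n \<omega>] by (intro divide_nonneg_pos)
        ultimately show "\<bar>D n \<omega> / (1 + S n \<omega>)\<bar> \<le> C * r n (K n) + C * 0" by linarith
      qed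
    qed
  qed
qed

theorem theoremA2:
  fixes P :: "nat \<Rightarrow> 'a measure" and p K k :: "nat \<Rightarrow> nat" and r :: "nat \<Rightarrow> nat \<Rightarrow> real"
    and \<delta> B :: real and \<theta> :: "nat \<Rightarrow> real vec"
    and X :: "nat \<Rightarrow> 'a \<Rightarrow> real mat" and \<epsilon> :: "nat \<Rightarrow> 'a \<Rightarrow> real vec" and V :: "nat \<Rightarrow> real mat \<Rightarrow> real mat"
    and Y Z \<Delta> \<theta>hat :: "nat \<Rightarrow> 'a \<Rightarrow> real vec" and Mvar :: "nat \<Rightarrow> 'a \<Rightarrow> real"
  defines "Y \<equiv> \<lambda>n \<omega>. response (X n \<omega>) (\<theta> n) (\<epsilon> n \<omega>)"
    and "Z \<equiv> \<lambda>n \<omega>. noise_term (V n (X n \<omega>)) (X n \<omega>) (\<epsilon> n \<omega>)"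
    and "\<theta>hat \<equiv> \<lambda>n \<omega>. debiased_est (r n (K n)) \<delta> B (V n (X n \<omega>)) (X n \<omega>) (Y n \<omega>)"
    and "\<Delta> \<equiv> \<lambda>n \<omega>. bias_term (r n (K n)) \<delta> B (V n (X n \<omega>)) (X n \<omega>) (Y n \<omega>) (\<theta> n)"
    and "Mvar \<equiv> \<lambda>n \<omega>. max_var (V n (X n \<omega>)) (X n \<omega>)"
  shows
    "(\<forall>n. sparse_regression (P n) n (p n) (K n) (k n) (r n) \<delta> B (\<theta> n) (X n) (\<epsilon> n) (V n) \<longrightarrow>
        (\<forall>\<omega>\<in>space (P n). sqrt (real n) \<cdot>\<^sub>v (\<theta>hat n \<omega> - \<theta> n) = \<Delta> n \<omega> + Z n \<omega>) \<and>
        (\<exists>\<kappa>. regular_cond_distr (P n) (mat_borel n (p n)) (X n) (vec_borel (p n)) (Z n) \<kappa> \<and>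
             (\<forall>x\<in>carrier_mat n (p n).
                mv_normal (p n) (0\<^sub>v (p n)) (V n x * gram x * (V n x)\<^sup>T) (\<kappa> x))))
     \<and>
     ((\<forall>\<^sub>F n in sequentially.
          sparse_regression (P n) n (p n) (K n) (k n) (r n) \<delta> B (\<theta> n) (X n) (\<epsilon> n) (V n) \<and> n < p n) \<and>
      holds_with_prob_tending_to_one P
        (\<lambda>n \<omega>. approx_inverse_cond (K n) (r n) (V n (X n \<omega>)) (X n \<omega>)) \<longrightarrow>
        ((\<lambda>n. r n (K n)) \<longlonglongrightarrow> 0 \<and>
         small_o_P_one P (\<lambda>n \<omega>. r n (K n) * sqrt (Mvar n \<omega> * ln (real (p n)))) \<longrightarrow>
           small_o_P_one P (\<lambda>n \<omega>. vec_linf (\<Delta> n \<omega>))) \<and>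
        ((\<lambda>n. r n (K n)) \<longlonglongrightarrow> 0 \<longrightarrow>
           small_o_P_one P (\<lambda>n \<omega>. vec_linf (\<Delta> n \<omega>) / (1 + sqrt (Mvar n \<omega> * ln (real (p n)))))) \<and>
        ((\<lambda>n. r n (K n)) \<in> O(\<lambda>n. real (K n) * sqrt (ln (real (p n)) / real n)) \<and>
         (\<lambda>n. real (K n)) \<in> o(\<lambda>n. sqrt (real n) / ln (real (p n))) \<and>
         big_O_P_one P Mvar \<longrightarrow>
           small_o_P_one P (\<lambda>n \<omega>. vec_linf (\<Delta> n \<omega>))))
     \<and>
     (\<forall>n q K V X \<eta>. X \<in> carrier_mat n q \<and> V \<in> carrier_mat q q \<and>
        mat_linf (V * gram X - 1\<^sub>m q) \<le> \<eta> \<longrightarrow>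
        approx_inverse_cond K (\<lambda>j. real j * \<eta>) V X)"
proof (intro conjI allI impI ballI)
  fix n \<omega>
  assume m: "sparse_regression (P n) n (p n) (K n) (k n) (r n) \<delta> B (\<theta> n) (X n) (\<epsilon> n) (V n)"
  then interpret sparse_regression "P n" n "p n" "K n" "k n" "r n" \<delta> B "\<theta> n" "X n" "\<epsilon> n" "V n" .
  show "sqrt (real n) \<cdot>\<^sub>v (\<theta>hat n \<omega> - \<theta> n) = \<Delta> n \<omega> + Z n \<omega>" if "\<omega> \<in> space (P n)"
    unfolding \<theta>hat_def \<Delta>_def Z_def Y_def
    by (rule debiased_decomposition[OF X_carrier[OF that] V_carrier[OF X_carrier[OF that]]
          noise_carrier[OF that] theta_carrier n_pos])
next
  fix n
  assume "sparse_regression (P n) n (p n) (K n) (k n) (r n) \<delta> B (\<theta> n) (X n) (\<epsilon> n) (V n)"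
  then interpret sparse_regression "P n" n "p n" "K n" "k n" "r n" \<delta> B "\<theta> n" "X n" "\<epsilon> n" "V n" .
  show "\<exists>\<kappa>. regular_cond_distr (P n) (mat_borel n (p n)) (X n) (vec_borel (p n)) (Z n) \<kappa> \<and>
      (\<forall>x\<in>carrier_mat n (p n). mv_normal (p n) (0\<^sub>v (p n)) (V n x * gram x * (V n x)\<^sup>T) (\<kappa> x))"
    unfolding Z_def using regular_cond_distr_noise mv_normal_noise_kernel by blast
next
  assume m: "(\<forall>\<^sub>F n in sequentially.
          sparse_regression (P n) n (p n) (K n) (k n) (r n) \<delta> B (\<theta> n) (X n) (\<epsilon> n) (V n) \<and> n < p n) \<and>
      holds_with_prob_tending_to_one P
        (\<lambda>n \<omega>. approx_inverse_cond (K n) (r n) (V n (X n \<omega>)) (X n \<omega>))"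
  note bias = bias_small_o[OF conjunct1[OF m] conjunct2[OF m]]
  have ps: "\<forall>\<^sub>F n in sequentially. prob_space (P n)"
    using conjunct1[OF m] by eventually_elim (auto simp: sparse_regression_def)
  have np: "\<forall>\<^sub>F n in sequentially. n < p n"
    using conjunct1[OF m] by eventually_elim simp
  show "small_o_P_one P (\<lambda>n \<omega>. vec_linf (\<Delta> n \<omega>))"
    if "(\<lambda>n. r n (K n)) \<longlonglongrightarrow> 0 \<and>
         small_o_P_one P (\<lambda>n \<omega>. r n (K n) * sqrt (Mvar n \<omega> * ln (real (p n))))"
    using that bias(1) unfolding \<Delta>_def Y_def Mvar_def by blast
  show "small_o_P_one P (\<lambda>n \<omega>. vec_linf (\<Delta> n \<omega>) / (1 + sqrt (Mvar n \<omega> * ln (real (p n)))))"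
    if "(\<lambda>n. r n (K n)) \<longlonglongrightarrow> 0"
    using bias(2)[OF that] unfolding \<Delta>_def Y_def Mvar_def .
  show "small_o_P_one P (\<lambda>n \<omega>. vec_linf (\<Delta> n \<omega>))"
    if h: "(\<lambda>n. r n (K n)) \<in> O(\<lambda>n. real (K n) * sqrt (ln (real (p n)) / real n)) \<and>
         (\<lambda>n. real (K n)) \<in> o(\<lambda>n. sqrt (real n) / ln (real (p n))) \<and>
         big_O_P_one P Mvar"
  proof -
    note rate = rate_tendsto_zero[OF conjunct1[OF h] conjunct1[OF conjunct2[OF h]] np]
    have "small_o_P_one P (\<lambda>n \<omega>. (r n (K n) * sqrt (ln (real (p n)))) * sqrt (Mvar n \<omega>))"
      using h by (intro small_o_P_one_mult_sqrt rate(1) ps) simp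
    also have "(\<lambda>n \<omega>. (r n (K n) * sqrt (ln (real (p n)))) * sqrt (Mvar n \<omega>)) =
        (\<lambda>n \<omega>. r n (K n) * sqrt (Mvar n \<omega> * ln (real (p n))))"
      by (simp add: real_sqrt_mult mult_ac)
    finally show ?thesis
      using bias(1)[OF rate(2)] unfolding \<Delta>_def Y_def Mvar_def by blast
  qed
next
  fix n q K V X \<eta>
  assume "X \<in> carrier_mat n q \<and> V \<in> carrier_mat q q \<and> mat_linf (V * gram X - 1\<^sub>m q) \<le> \<eta>"
  then show "approx_inverse_cond K (\<lambda>j. real j * \<eta>) V X"
    using approx_inverse_cond_of_entrywise by blast
qed

end
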